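(* Let $n\in\mathbb{N}$ and let $a\in ES^m(\mathbb{Z}^n\times\mathbb{T}^n)$ (an elliptic symbol of order $m$) with $m>0$. Let $A$ be the operator in $\ell^2(\mathbb{Z}^n)$ given by $Au:=T_au$ with $\operatorname{Dom}(A)=\mathcal{S}(\mathbb{Z}^n)$, and let $A^\dagger$ be the operator in $\ell^2(\mathbb{Z}^n)$ given by $A^\dagger u:=(T_a)^\dagger u$ with $\operatorname{Dom}(A^\dagger)=\mathcal{S}(\mathbb{Z}^n)$, where $(T_a)^\dagger$ is the formal adjoint of $T_a$. Assume that $A$ is formally self-adjoint, that is, $A=A^\dagger$. Then $A$, as an operator in $\ell^2(\mathbb{Z}^n)$, is essentially self-adjoint on $\mathcal{S}(\mathbb{Z}^n)$.
   Context: Notation. $\mathbb{T}^n=\mathbb{R}^n/\mathbb{Z}^n$, $|k|$ is the Euclidean norm of $k\in\mathbb{Z}^n$, $\mathbb{N}_0=\{0,1,2,\dots\}$. For $u$ on $\mathbb{Z}^n$, $\Delta_{k_j}u(k):=u(k+e_j)-u(k)$ ($e_j$ the $j$-th standard unit vector) and $\Delta_k^{\alpha}:=\Delta_{k_1}^{\alpha_1}\cdots\Delta_{k_n}^{\alpha_n}$ for $\alpha\in\mathbb{N}_0^n$. On $\mathbb{T}^n$, $D_{x_j}^{(l)}:=\prod_{r=0}^{l-1}\left(\frac{1}{2\pi i}\frac{\partial}{\partial x_j}-r\right)$ for $l\in\mathbb{N}$, $D_{x_j}^{(0)}:=1$, and $D_x^{(\beta)}:=D_{x_1}^{(\beta_1)}\cdots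 D_{x_n}^{(\beta_n)}$ for $\beta\in\mathbb{N}_0^n$. Symbols. For $m\in\mathbb{R}$, $S^m(\mathbb{Z}^n\times\mathbb{T}^n)$ is the set of $a\colon\mathbb{Z}^n\times\mathbb{T}^n\to\mathbb{C}$ such that $a(k,\cdot)\in C^\infty(\mathbb{T}^n)$ for all $k$ and, for all $\alpha,\beta\in\mathbb{N}_0^n$, there is $C_{\alpha,\beta}>0$ with $|D_x^{(\beta)}\Delta_k^{\alpha}a(k,x)|\le C_{\alpha,\beta}(1+|k|)^{m-|\alpha|}$ for all $(k,x)$. $ES^m(\mathbb{Z}^n\times\mathbb{T}^n)$ is the set of $a\in S^m(\mathbb{Z}^n\times\mathbb{T}^n)$ for which there are constants $C>0$, $R>0$ with $|a(k,x)|\ge C(1+|k|)^m$ for all $x\in\mathbb{T}^n$ and all $k$ with $|k|>R$. Operators. $\mathcal{S}(\mathbb{Z}^n)$ is the space of $u\colon\mathbb{Z}^n\to\mathbb{C}$ with $\sup_k|k^\alpha(\Delta_k^\beta u)(k)|<\infty$ for all $\alpha,\beta\in\mathbb{N}_0^n$. $(u,v):=\sum_{k}u(k)\overline{v(k)}$ is the inner product of $\ell^2(\mathbb{Z}^n)$. $\widehat{u}(x):=\sum_{k}e^{-2\pi i k\cdot x}u(k)$. For $a\in S^m(\mathbb{Z}^n\times\mathbb{T}^n)$, $(T_au)(k):=\int_{\mathbb{T}^n}e^{2\pi i k\cdot x}a(k,x)\widehat{u}(x)\,dx$ for $u\in\mathcal{S}(\mathbb{Z}^n)$; $T_a$ maps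 $\mathcal{S}(\mathbb{Z}^n)$ continuously into itself. Its formal adjoint $(T_a)^\dagger\colon\mathcal{S}(\mathbb{Z}^n)\to\mathcal{S}(\mathbb{Z}^n)$ is defined by $(T_au,v)=(u,(T_a)^\dagger v)$ for all $u,v\in\mathcal{S}(\mathbb{Z}^n)$. Essentially self-adjoint on $\mathcal{S}(\mathbb{Z}^n)$ means that the closure of $A$ (with domain $\mathcal{S}(\mathbb{Z}^n)$) in $\ell^2(\mathbb{Z}^n)$ is a self-adjoint operator. *)

theory Defs
  imports "HOL-Analysis.Analysis"
begin

text \<open>
  The lattice is \<open>int ^ 'n\<close>, with \<open>n = CARD('n)\<close>, and multi-indices have type \<open>nat ^ 'n\<close>.
  A function on the torus is a function on \<open>real ^ 'n\<close> that is invariant under integer translations.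
\<close>

definition rvec :: "int ^ 'n \<Rightarrow> real ^ 'n"
  where "rvec k = (\<chi> j. of_int (k $ j))"

definition mi_order :: "nat ^ 'n \<Rightarrow> nat"
  where "mi_order \<alpha> = (\<Sum>j\<in>UNIV. \<alpha> $ j)"

text \<open>
  An enumeration of the coordinates, fixing the order of the factors in the products of operators
  below. On the functions to which they are applied (arbitrary functions on the lattice, smooth
  functions on the torus) the factors commute, so the choice is immaterial.
\<close>

definition coord_list :: "'n::finite list"
  where "coord_list = (SOME js. distinct js \<and> set js = UNIV)"

lemma coord_list: "distinct (coord_list :: 'n::finite list)" "set (coord_list :: 'n list) = UNIV"
proof -
  have "\<exists>js :: 'n list. distinct js \<and> set js = UNIV"
    using finite_distinct_list[OF finite, of "UNIV :: 'n set"] by blast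
  then have "distinct (coord_list :: 'n list) \<and> set (coord_list :: 'n list) = UNIV"
    unfolding coord_list_def by (rule someI_ex)
  then show "distinct (coord_list :: 'n list)" "set (coord_list :: 'n list) = UNIV"
    by auto
qed


subsection \<open>Difference and differential operators\<close>

definition fdiff :: "'n \<Rightarrow> (int ^ 'n \<Rightarrow> complex) \<Rightarrow> int ^ 'n \<Rightarrow> complex"
  where "fdiff j u k = u (k + axis j 1) - u k"

definition fdiff_multi :: "nat ^ 'n \<Rightarrow> (int ^ 'n \<Rightarrow> complex) \<Rightarrow> int ^ 'n \<Rightarrow> complex"
  where "fdiff_multi \<alpha> = foldr (\<lambda>j. fdiff j ^^ (\<alpha> $ j)) coord_list"

definition pderivative :: "'n \<Rightarrow> (real ^ 'n \<Rightarrow> complex) \<Rightarrow> real ^ 'n \<Rightarrow> complex"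
  where "pderivative j f x = vector_derivative (\<lambda>t. f (x + t *\<^sub>R axis j 1)) (at 0)"

text \<open>The classical definition: all iterated partial derivatives exist and are continuous.\<close>

definition smooth :: "(real ^ 'n \<Rightarrow> complex) \<Rightarrow> bool"
  where "smooth f \<longleftrightarrow>
    (\<forall>js. continuous_on UNIV (foldr pderivative js f) \<and>
      (\<forall>j x. (\<lambda>t. foldr pderivative js f (x + t *\<^sub>R axis j 1)) differentiable (at (0::real))))"

definition periodic :: "(real ^ 'n \<Rightarrow> complex) \<Rightarrow> bool"
  where "periodic f \<longleftrightarrow> (\<forall>l x. f (x + rvec l) = f x)"

primrec falling_D :: "'n \<Rightarrow> nat \<Rightarrow> (real ^ 'n \<Rightarrow> complex) \<Rightarrow> real ^ 'n \<Rightarrow> complex"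
  where
    "falling_D j 0 f = f"
  | "falling_D j (Suc l) f =
      (\<lambda>x. 1 / (2 * of_real pi * \<i>) * pderivative j (falling_D j l f) x - of_nat l * falling_D j l f x)"

definition falling_D_multi :: "nat ^ 'n \<Rightarrow> (real ^ 'n \<Rightarrow> complex) \<Rightarrow> real ^ 'n \<Rightarrow> complex"
  where "falling_D_multi \<beta> = foldr (\<lambda>j. falling_D j (\<beta> $ j)) coord_list"


subsection \<open>Symbol classes\<close>

definition symbol_class :: "real \<Rightarrow> (int ^ 'n \<Rightarrow> real ^ 'n \<Rightarrow> complex) set"
  where "symbol_class m = {a.
    (\<forall>k. periodic (a k) \<and> smooth (a k)) \<and>
    (\<forall>\<alpha> \<beta>. \<exists>C>0. \<forall>k x.
      cmod (falling_D_multi \<beta> (\<lambda>y. fdiff_multi \<alpha> (\<lambda>l. a l y) k) x)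
        \<le> C * (1 + norm (rvec k)) powr (m - real (mi_order \<alpha>)))}"

definition elliptic_symbol_class :: "real \<Rightarrow> (int ^ 'n \<Rightarrow> real ^ 'n \<Rightarrow> complex) set"
  where "elliptic_symbol_class m = {a \<in> symbol_class m.
    \<exists>C>0. \<exists>R>0. \<forall>k x. norm (rvec k) > R \<longrightarrow> cmod (a k x) \<ge> C * (1 + norm (rvec k)) powr m}"


subsection \<open>Pseudo-differential operators on the lattice\<close>

definition schwartz :: "(int ^ 'n \<Rightarrow> complex) set"
  where "schwartz = {u. \<forall>\<alpha> \<beta> :: nat ^ 'n.
    bdd_above (range (\<lambda>k. cmod ((\<Prod>j\<in>UNIV. of_int (k $ j) ^ (\<alpha> $ j)) * fdiff_multi \<beta> u k)))}"

definition lattice_fourier :: "(int ^ 'n \<Rightarrow> complex) \<Rightarrow> real ^ 'n \<Rightarrow> complex"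
  where "lattice_fourier u x = (\<Sum>\<^sub>\<infinity>k. exp (- 2 * pi * \<i> * of_real (rvec k \<bullet> x)) * u k)"

text \<open>The integral over the torus is the integral over the fundamental domain \<open>[0,1]\<^sup>n\<close>.\<close>

definition pdo :: "(int ^ 'n \<Rightarrow> real ^ 'n \<Rightarrow> complex) \<Rightarrow> (int ^ 'n \<Rightarrow> complex) \<Rightarrow> int ^ 'n \<Rightarrow> complex"
  where "pdo a u k =
    (LBINT x:cbox 0 1. exp (2 * pi * \<i> * of_real (rvec k \<bullet> x)) * a k x * lattice_fourier u x)"


subsection \<open>Unbounded operators in \<open>\<ell>\<^sup>2\<close>\<close>

definition l2 :: "('i \<Rightarrow> complex) set"
  where "l2 = {u. (\<lambda>k. (cmod (u k))\<^sup>2) summable_on UNIV}"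

definition l2_inner :: "('i \<Rightarrow> complex) \<Rightarrow> ('i \<Rightarrow> complex) \<Rightarrow> complex"
  where "l2_inner u v = (\<Sum>\<^sub>\<infinity>k. u k * cnj (v k))"

definition l2_dist :: "('i \<Rightarrow> complex) \<Rightarrow> ('i \<Rightarrow> complex) \<Rightarrow> real"
  where "l2_dist u v = sqrt (\<Sum>\<^sub>\<infinity>k. (cmod (u k - v k))\<^sup>2)"

text \<open>An operator in \<open>\<ell>\<^sup>2\<close> is represented by its graph; its domain is the \<^const>\<open>Domain\<close> of the graph.\<close>

type_synonym 'i l2_graph = "(('i \<Rightarrow> complex) \<times> ('i \<Rightarrow> complex)) set"

definition op_graph :: "('i \<Rightarrow> complex) set \<Rightarrow> (('i \<Rightarrow> complex) \<Rightarrow> 'i \<Rightarrow> complex) \<Rightarrow> 'i l2_graph"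
  where "op_graph D F = {(u, F u) | u. u \<in> D}"

definition l2_operator :: "'i l2_graph \<Rightarrow> bool"
  where "l2_operator G \<longleftrightarrow>
    G \<subseteq> l2 \<times> l2 \<and> single_valued G \<and> ((\<lambda>_. 0), (\<lambda>_. 0)) \<in> G \<and>
    (\<forall>(u, f)\<in>G. \<forall>(v, g)\<in>G. ((\<lambda>k. u k + v k), (\<lambda>k. f k + g k)) \<in> G) \<and>
    (\<forall>c. \<forall>(u, f)\<in>G. ((\<lambda>k. c * u k), (\<lambda>k. c * f k)) \<in> G)"

definition op_closure :: "'i l2_graph \<Rightarrow> 'i l2_graph"
  where "op_closure G = {(u, f) \<in> l2 \<times> l2.
    \<forall>\<epsilon>>0. \<exists>(v, g)\<in>G. l2_dist u v < \<epsilon> \<and> l2_dist f g < \<epsilon>}"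

definition densely_defined :: "'i l2_graph \<Rightarrow> bool"
  where "densely_defined G \<longleftrightarrow> (\<forall>u\<in>l2. \<forall>\<epsilon>>0. \<exists>v\<in>Domain G. l2_dist u v < \<epsilon>)"

definition op_adjoint :: "'i l2_graph \<Rightarrow> 'i l2_graph"
  where "op_adjoint G = {(v, w) \<in> l2 \<times> l2. \<forall>(u, f)\<in>G. l2_inner f v = l2_inner u w}"

definition self_adjoint :: "'i l2_graph \<Rightarrow> bool"
  where "self_adjoint G \<longleftrightarrow> l2_operator G \<and> densely_defined G \<and> op_adjoint G = G"

definition essentially_self_adjoint :: "'i l2_graph \<Rightarrow> bool"
  where "essentially_self_adjoint G \<longleftrightarrow> l2_operator G \<and> self_adjoint (op_closure G)"

text \<open>
  The formal adjoint of an operator on the Schwartz space, as a relation; it determines \<open>B\<close> on the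
  Schwartz space uniquely.
\<close>

definition is_formal_adjoint ::
    "((int ^ 'n \<Rightarrow> complex) \<Rightarrow> int ^ 'n \<Rightarrow> complex) \<Rightarrow> ((int ^ 'n \<Rightarrow> complex) \<Rightarrow> int ^ 'n \<Rightarrow> complex) \<Rightarrow> bool"
  where "is_formal_adjoint T B \<longleftrightarrow>
    B ` schwartz \<subseteq> schwartz \<and>
    (\<forall>u\<in>schwartz. \<forall>v\<in>schwartz. l2_inner (T u) v = l2_inner u (B v))"

end

theory Submission
  imports Defs
begin

text \<open>
  In the standard basis, the operator has the matrix \<open>K k l = c k (k - l)\<close>, where \<open>c k\<close> is the sequence
  of Fourier coefficients of \<open>a k\<close>. As \<open>K\<close> is Hermitian, testing with basis vectors shows that the
  adjoint consists of pairs \<open>(v, w)\<close> in \<open>\<ell>\<^sup>2\<close> with \<open>w = K v\<close>; it remains to approximate such a pair in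
  the graph norm. Put \<open>\<langle>k\<rangle> = 1 + |k|\<close>. If \<open>d k\<close> are the Fourier coefficients of \<open>1 / a k\<close> for large \<open>|k|\<close>, then
  \<open>v k = (\<Sum>j. d k (k - j) * w j) - (\<Sum>j. d k (k - j) * (\<Sum>l. (c j (j - l) - c k (j - l)) * v l))\<close>.
  The first sum gains \<open>m\<close> powers of \<open>\<langle>k\<rangle>\<close>, and the second one gains a single power, because the
  differences of \<open>c\<close> in the first argument have order \<open>m - 1\<close>. Iterating, \<open>\<langle>k\<rangle>\<^sup>m v k\<close> is square summable,
  and then the truncations of \<open>v\<close> to finite sets converge to \<open>v\<close> in the graph norm.
\<close>


subsection \<open>Convolution on the lattice\<close>

text \<open>In the identity for \<open>v k\<close> the coefficients are frozen at the row
  \<open>k\<close>: \<open>d k\<close> and \<open>c k\<close> carry the same index, so they are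
  inverse to each other under plain convolution and the identity is exact for large |k|. The whole
  error comes from replacing the row \<open>c j\<close> by \<open>c k\<close>, so first differences
  of the symbol take the place of an asymptotic calculus for composed symbols. The obstacle is that
  this error contains \<open>v\<close> itself, of which only square summability is known at the
  start. Peetre's inequality moves a weight from one lattice point to another at the price of a
  power of their distance, and the rapid decay of Fourier coefficients absorbs that power. What
  remains is convolution with one fixed summable function, \<open>decay\<close>, which is bounded on
  square summable sequences; hence the gain of one power can be repeated. The rapid decay comes from
  integration by parts in one coordinate at a time, for the symbol and for its reciprocal, with
  constants uniform in \<open>k\<close>.\<close>

lemma summable_on_comparison_norm:
  fixes f :: "'a \<Rightarrow> 'b::banach"
  assumes "g summable_on A" "\<And>x. x \<in> A \<Longrightarrow> norm (f x) \<le> g x"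
  shows "(\<lambda>x. norm (f x)) summable_on A" and "f summable_on A" and "norm (infsum f A) \<le> infsum g A"
proof -
  show 1: "(\<lambda>x. norm (f x)) summable_on A"
    by (rule summable_on_comparison_test[OF assms]) auto
  then show "f summable_on A"
    by (rule abs_summable_summable)
  have "norm (infsum f A) \<le> infsum (\<lambda>x. norm (f x)) A"
    using 1 by (rule norm_infsum_bound)
  also have "\<dots> \<le> infsum g A"
    using 1 assms by (rule infsum_mono)
  finally show "norm (infsum f A) \<le> infsum g A" .
qed

lemma infsum_Cauchy_Schwarz:
  fixes f g :: "'a \<Rightarrow> real"
  assumes f: "(\<lambda>i. (f i)\<^sup>2) summable_on A" and g: "(\<lambda>i. (g i)\<^sup>2) summable_on A"
  shows "(\<lambda>i. \<bar>f i * g i\<bar>) summable_on A"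
    and "infsum (\<lambda>i. \<bar>f i * g i\<bar>) A \<le> sqrt (infsum (\<lambda>i. (f i)\<^sup>2) A) * sqrt (infsum (\<lambda>i. (g i)\<^sup>2) A)"
proof -
  have *: "sum (\<lambda>i. \<bar>f i * g i\<bar>) F \<le> sqrt (infsum (\<lambda>i. (f i)\<^sup>2) A) * sqrt (infsum (\<lambda>i. (g i)\<^sup>2) A)"
    if F: "finite F" "F \<subseteq> A" for F
  proof -
    have "sum (\<lambda>i. \<bar>f i * g i\<bar>) F \<le> L2_set f F * L2_set g F"
      using L2_set_mult_ineq[of f g F] by (simp add: abs_mult)
    also have "\<dots> \<le> sqrt (infsum (\<lambda>i. (f i)\<^sup>2) A) * sqrt (infsum (\<lambda>i. (g i)\<^sup>2) A)"
      unfolding L2_set_def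
      by (intro mult_mono real_sqrt_le_mono finite_sum_le_infsum f g F)
        (auto intro: sum_nonneg infsum_nonneg)
    finally show ?thesis .
  qed
  show 1: "(\<lambda>i. \<bar>f i * g i\<bar>) summable_on A"
    by (rule nonneg_bdd_above_summable_on) (use * in \<open>auto intro!: bdd_aboveI2\<close>)
  show "infsum (\<lambda>i. \<bar>f i * g i\<bar>) A \<le> sqrt (infsum (\<lambda>i. (f i)\<^sup>2) A) * sqrt (infsum (\<lambda>i. (g i)\<^sup>2) A)"
    by (rule infsum_le_finite_sums[OF 1]) (use * in auto)
qed

lemma summable_on_Times_nonneg:
  fixes f :: "'a \<Rightarrow> real" and g :: "'b \<Rightarrow> real"
  assumes "f summable_on A" "g summable_on B" "\<And>x. x \<in> A \<Longrightarrow> 0 \<le> f x" "\<And>y. y \<in> B \<Longrightarrow> 0 \<le> g y"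
  shows "(\<lambda>(x, y). f x * g y) summable_on (A \<times> B)"
  by (rule summable_on_SigmaI[where g = "\<lambda>x. f x * infsum g B"])
    (use assms in \<open>auto intro!: has_sum_cmult_right summable_on_cmult_left has_sum_infsum\<close>)

lemma summable_on_convolution:
  fixes h g :: "'a::ab_group_add \<Rightarrow> real"
  assumes "h summable_on UNIV" "g summable_on UNIV" "\<And>x. 0 \<le> h x" "\<And>x. 0 \<le> g x"
  shows "(\<lambda>(k, l). h (k - l) * g l) summable_on (UNIV \<times> UNIV)"
proof -
  have "(\<lambda>(x, y). h x * g y) summable_on (UNIV \<times> UNIV)"
    by (rule summable_on_Times_nonneg) (use assms in auto)
  also have "?this \<longleftrightarrow> (\<lambda>(k, l). h (k - l) * g l) summable_on (UNIV \<times> UNIV)"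
    by (rule summable_on_reindex_bij_witness[of _ "\<lambda>(k, l). (k - l, l)" "\<lambda>(k, l). (k + l, l)"]) auto
  finally show ?thesis .
qed

lemma infsum_reflect:
  fixes h :: "'a::ab_group_add \<Rightarrow> real"
  shows "(\<lambda>l. h (k - l)) summable_on UNIV \<longleftrightarrow> h summable_on UNIV"
    and "infsum (\<lambda>l. h (k - l)) UNIV = infsum h UNIV"
proof -
  have "bij_betw (\<lambda>l. k - l) UNIV (UNIV :: 'a set)"
    by (rule bij_betwI[of _ _ _ "\<lambda>l. k - l"]) auto
  then show "(\<lambda>l. h (k - l)) summable_on UNIV \<longleftrightarrow> h summable_on UNIV"
    and "infsum (\<lambda>l. h (k - l)) UNIV = infsum h UNIV"
    by (rule summable_on_reindex_bij_betw, rule infsum_reindex_bij_betw)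
qed

text \<open>Young's inequality for a summable kernel acting on square summable sequences. Splitting
  \<open>h\<close> into \<open>sqrt h * sqrt h\<close> and applying Cauchy-Schwarz bounds the
  squared convolution pointwise by \<open>infsum h UNIV\<close> times the convolution of
  \<open>h\<close> with the square of \<open>g\<close>; summing over \<open>k\<close> first gives
  the second factor \<open>infsum h UNIV\<close>.\<close>

lemma conv_l2:
  fixes h g :: "'a::ab_group_add \<Rightarrow> real"
  assumes h: "h summable_on UNIV" "\<And>x. 0 \<le> h x"
    and g: "(\<lambda>l. (g l)\<^sup>2) summable_on UNIV" "\<And>x. 0 \<le> g x"
  shows "(\<lambda>l. h (k - l) * g l) summable_on UNIV"
    and "(\<lambda>k. (\<Sum>\<^sub>\<infinity>l. h (k - l) * g l)\<^sup>2) summable_on UNIV"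
    and "(\<Sum>\<^sub>\<infinity>k. (\<Sum>\<^sub>\<infinity>l. h (k - l) * g l)\<^sup>2) \<le> (infsum h UNIV)\<^sup>2 * (\<Sum>\<^sub>\<infinity>l. (g l)\<^sup>2)"
proof -
  define H where "H = infsum h UNIV"
  have H: "H \<ge> 0"
    unfolding H_def using h by (auto intro: infsum_nonneg)
  let ?p = "\<lambda>k l. h (k - l) * (g l)\<^sup>2"
  have 2: "(\<lambda>(k, l). ?p k l) summable_on (UNIV \<times> UNIV)"
    by (rule summable_on_convolution) (use assms in auto)
  have p: "?p k summable_on UNIV" for k
    using summable_on_SigmaD1[OF 2, of k] by simp
  have hk: "(\<lambda>l. h (k - l)) summable_on UNIV" "(\<Sum>\<^sub>\<infinity>l. h (k - l)) = H" for k
    using h by (simp_all add: infsum_reflect H_def)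
  have eq: "\<bar>sqrt (h (k - l)) * (sqrt (h (k - l)) * g l)\<bar> = h (k - l) * g l" for k l
    using h g by (simp flip: mult.assoc)
  have sq: "(sqrt (h (k - l)))\<^sup>2 = h (k - l)" "(sqrt (h (k - l)) * g l)\<^sup>2 = ?p k l" for k l
    using h g by (simp_all add: power_mult_distrib)
  note cs = infsum_Cauchy_Schwarz[of "\<lambda>l. sqrt (h (k - l))" UNIV "\<lambda>l. sqrt (h (k - l)) * g l" for k,
      unfolded eq sq, OF hk(1) p, unfolded hk(2)]
  show "(\<lambda>l. h (k - l) * g l) summable_on UNIV"
    by (rule cs)
  have le: "(\<Sum>\<^sub>\<infinity>l. h (k - l) * g l)\<^sup>2 \<le> H * (\<Sum>\<^sub>\<infinity>l. ?p k l)" for k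
  proof -
    have "(\<Sum>\<^sub>\<infinity>l. h (k - l) * g l)\<^sup>2 \<le> (sqrt H * sqrt (\<Sum>\<^sub>\<infinity>l. ?p k l))\<^sup>2"
      by (rule power_mono[OF cs(2)]) (use h g in \<open>auto intro: infsum_nonneg\<close>)
    also have "\<dots> = H * (\<Sum>\<^sub>\<infinity>l. ?p k l)"
      using H h by (simp add: power_mult_distrib infsum_nonneg)
    finally show ?thesis .
  qed
  have s: "(\<lambda>k. \<Sum>\<^sub>\<infinity>l. ?p k l) summable_on UNIV"
    using summable_on_Sigma_banach[OF 2] by simp
  have tot: "(\<Sum>\<^sub>\<infinity>k. \<Sum>\<^sub>\<infinity>l. ?p k l) = H * (\<Sum>\<^sub>\<infinity>l. (g l)\<^sup>2)"
  proof -
    have "(\<Sum>\<^sub>\<infinity>k. \<Sum>\<^sub>\<infinity>l. ?p k l) = (\<Sum>\<^sub>\<infinity>l. \<Sum>\<^sub>\<infinity>k. ?p k l)"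
      by (rule infsum_swap_banach[OF 2])
    also have "\<dots> = (\<Sum>\<^sub>\<infinity>l. H * (g l)\<^sup>2)"
    proof (rule infsum_cong)
      fix l
      have "(\<Sum>\<^sub>\<infinity>k. h (k - l)) = H"
        unfolding H_def by (rule infsum_reindex_bij_betw, rule bij_betwI[of _ _ _ "\<lambda>k. k + l"]) auto
      then show "(\<Sum>\<^sub>\<infinity>k. ?p k l) = H * (g l)\<^sup>2"
        by (simp add: infsum_cmult_left')
    qed
    finally show ?thesis
      by (simp add: infsum_cmult_right')
  qed
  show 3: "(\<lambda>k. (\<Sum>\<^sub>\<infinity>l. h (k - l) * g l)\<^sup>2) summable_on UNIV"
    by (rule summable_on_comparison_test[OF summable_on_cmult_right[OF s, of H]]) (use le in auto)
  have "(\<Sum>\<^sub>\<infinity>k. (\<Sum>\<^sub>\<infinity>l. h (k - l) * g l)\<^sup>2) \<le> (\<Sum>\<^sub>\<infinity>k. H * (\<Sum>\<^sub>\<infinity>l. ?p k l))"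
    by (rule infsum_mono[OF 3 summable_on_cmult_right[OF s]]) (use le in auto)
  also have "\<dots> = H\<^sup>2 * (\<Sum>\<^sub>\<infinity>l. (g l)\<^sup>2)"
    unfolding infsum_cmult_right' tot by (simp add: power2_eq_square)
  finally show "(\<Sum>\<^sub>\<infinity>k. (\<Sum>\<^sub>\<infinity>l. h (k - l) * g l)\<^sup>2) \<le> (infsum h UNIV)\<^sup>2 * (\<Sum>\<^sub>\<infinity>l. (g l)\<^sup>2)"
    unfolding H_def .
qed

section \<open>Polynomial weights on the lattice and Peetre's inequality\<close>

definition bracket :: "int ^ 'n \<Rightarrow> real"
  where "bracket k = 1 + norm (rvec k)"

lemma rvec_simps [simp]:
  "rvec (k + l) = rvec k + rvec l" "rvec (k - l) = rvec k - rvec l" "rvec (- k) = - rvec k" "rvec 0 = 0"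
  "rvec k $ i = of_int (k $ i)"
  by (simp_all add: rvec_def vec_eq_iff)

lemma rvec_axis [simp]: "rvec (axis i 1) = axis i 1"
  by (simp add: vec_eq_iff axis_def)

lemma bracket_ge_1: "1 \<le> bracket k" and bracket_pos [simp]: "0 < bracket k" and bracket_nonneg [simp]: "0 \<le> bracket k"
  by (simp_all add: bracket_def add_pos_nonneg)

lemma bracket_neq_0 [simp]: "bracket k \<noteq> 0"
  using bracket_pos[of k] by linarith

lemma bracket_minus [simp]: "bracket (- k) = bracket k"
  by (simp add: bracket_def)

lemma bracket_diff_commute: "bracket (k - l) = bracket (l - k)"
  by (simp add: bracket_def norm_minus_commute)

lemma bracket_add_le: "bracket (k + l) \<le> bracket k * bracket l"
proof -
  have "norm (rvec k + rvec l) \<le> norm (rvec k) + norm (rvec l) + norm (rvec k) * norm (rvec l)"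
    using norm_triangle_ineq[of "rvec k" "rvec l"] by (smt (verit) mult_nonneg_nonneg norm_ge_zero)
  then show ?thesis
    by (simp add: bracket_def algebra_simps)
qed

text \<open>Peetre's inequality. For negative \<open>s\<close> submultiplicativity is applied to
  \<open>k = (k + l) + (- l)\<close>, which exchanges the roles of \<open>k\<close> and
  \<open>k + l\<close>.\<close>

lemma bracket_peetre: "bracket (k + l) powr s \<le> bracket k powr s * bracket l powr \<bar>s\<bar>"
proof (cases "s \<ge> 0")
  case True
  then have "bracket (k + l) powr s \<le> (bracket k * bracket l) powr s"
    by (intro powr_mono2 bracket_add_le) auto
  then show ?thesis
    using True by (simp add: powr_mult)
next
  case False
  have "bracket k \<le> bracket (k + l) * bracket l"
    using bracket_add_le[of "k + l" "- l"] by simp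
  then have "(bracket (k + l) * bracket l) powr s \<le> bracket k powr s"
    using False by (intro powr_mono2') auto
  then have "bracket (k + l) powr s * bracket l powr s * bracket l powr (- s) \<le> bracket k powr s * bracket l powr (- s)"
    by (simp add: powr_mult mult_right_mono)
  then show ?thesis
    using False by (simp add: mult.assoc flip: powr_add)
qed

lemma bracket_peetre': "bracket k powr s \<le> bracket (k - l) powr \<bar>s\<bar> * bracket l powr s"
  using bracket_peetre[of l "k - l" s] by (simp add: mult.commute)

lemma abs_le_bracket: "\<bar>of_int (k $ i)\<bar> \<le> bracket k"
  using component_le_norm_cart[of "rvec k" i] by (simp add: bracket_def)

text \<open>The exponent is twice the dimension so that each coordinate receives a factor of order
  two: \<open>decay k\<close> is at most the product of the \<open>1 / (1 + k_i^2)\<close>, and that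
  product is summable because each one-dimensional factor is.\<close>

definition decay :: "int ^ 'n \<Rightarrow> real"
  where "decay k = 1 / bracket k ^ (2 * CARD('n))"

lemma decay_nonneg [simp]: "0 \<le> decay k"
  by (simp add: decay_def)

lemma summable_inverse_square_int: "(\<lambda>k::int. 1 / (1 + (of_int k)\<^sup>2) :: real) summable_on UNIV"
proof -
  have "summable (\<lambda>n. 2 * inverse (real (Suc n) ^ 2))"
    using inverse_power_summable[of 2, where 'a = real]
    by (intro summable_mult) (simp add: summable_Suc_iff[of "\<lambda>n. inverse (real n ^ 2)"] del: of_nat_Suc)
  then have "summable (\<lambda>n. 1 / (1 + (real n)\<^sup>2))"
  proof (rule summable_comparison_test[rotated], intro exI[of _ 0] allI impI)
    fix n :: nat
    \<comment> \<open>Expanded, this square is exactly the inequality that compares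
      \<open>1 / (1 + n^2)\<close> with twice the shifted series of inverse squares.\<close>
    have "0 \<le> (real n - 1)\<^sup>2"
      by simp
    then have "(real (Suc n))\<^sup>2 \<le> 2 * (1 + (real n)\<^sup>2)"
      by (simp add: power2_eq_square algebra_simps)
    moreover have "0 < 1 + (real n)\<^sup>2"
      by (simp add: add_pos_nonneg)
    ultimately show "norm (1 / (1 + (real n)\<^sup>2)) \<le> 2 * inverse (real (Suc n) ^ 2)"
      by (simp add: field_simps)
  qed
  then have n: "(\<lambda>n. 1 / (1 + (real n)\<^sup>2)) summable_on UNIV"
    by (intro norm_summable_imp_summable_on) simp
  let ?f = "\<lambda>k::int. 1 / (1 + (of_int k)\<^sup>2) :: real"
  have "?f summable_on range int" "?f summable_on range (\<lambda>n. - int n)"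
    using n by (auto simp: summable_on_reindex inj_on_def o_def)
  then have "?f summable_on (range int \<union> range (\<lambda>n. - int n))"
    by (rule summable_on_union)
  moreover have "range int \<union> range (\<lambda>n. - int n) = UNIV"
  proof -
    have "k \<in> range int \<union> range (\<lambda>n. - int n)" for k
      by (cases k rule: int_cases2) auto
    then show ?thesis by auto
  qed
  ultimately show ?thesis by simp
qed

lemma summable_decay: "(decay :: int ^ 'n \<Rightarrow> real) summable_on UNIV"
proof -
  let ?f = "\<lambda>k::int. 1 / (1 + (of_int k)\<^sup>2) :: real"
  have "(\<lambda>g. \<Prod>i\<in>(UNIV :: 'n set). ?f (g i)) summable_on PiE UNIV (\<lambda>_. UNIV)"
    by (rule abs_summable_summable, subst abs_summable_equivalent, rule abs_summable_on_prod_PiE)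
      (use summable_inverse_square_int in \<open>auto simp flip: abs_summable_equivalent\<close>)
  then have "(\<lambda>g. \<Prod>i\<in>(UNIV :: 'n set). ?f (g i)) summable_on UNIV"
    by (simp add: PiE_UNIV_domain)
  also have "?this \<longleftrightarrow> (\<lambda>k :: int ^ 'n. \<Prod>i\<in>UNIV. ?f (k $ i)) summable_on UNIV"
    by (rule summable_on_reindex_bij_witness[of _ "\<lambda>k i. k $ i" "\<lambda>g. \<chi> i. g i"]) auto
  finally show ?thesis
  proof (rule summable_on_comparison_test)
    fix k :: "int ^ 'n"
    have "(\<Prod>i\<in>(UNIV :: 'n set). 1 + (of_int (k $ i) :: real)\<^sup>2) \<le> (\<Prod>i\<in>(UNIV :: 'n set). (bracket k)\<^sup>2)"
    proof (rule prod_mono, safe)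
      fix i
      have "\<bar>of_int (k $ i)\<bar>\<^sup>2 \<le> (norm (rvec k))\<^sup>2"
        using component_le_norm_cart[of "rvec k" i] by (intro power_mono) auto
      then show "1 + (of_int (k $ i) :: real)\<^sup>2 \<le> (bracket k)\<^sup>2"
        unfolding bracket_def power2_sum by (simp add: add_increasing2)
    qed simp
    also have "\<dots> = bracket k ^ (2 * CARD('n))"
      by (simp flip: power_mult)
    finally have "1 / bracket k ^ (2 * CARD('n)) \<le> 1 / (\<Prod>i\<in>(UNIV :: 'n set). 1 + (of_int (k $ i) :: real)\<^sup>2)"
      by (intro divide_left_mono mult_pos_pos prod_pos) (auto simp: add_pos_nonneg)
    then show "decay k \<le> (\<Prod>i\<in>UNIV. ?f (k $ i))"
      by (simp add: decay_def prod_dividef)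
  qed simp
qed


subsection \<open>Calculus on the torus\<close>

lemma periodicD: "periodic f \<Longrightarrow> f (x + rvec l) = f x"
  by (simp add: periodic_def)

lemma periodic_shift_axis: "periodic f \<Longrightarrow> f (x + axis i 1) = f x"
  using periodicD[of f x "axis i 1"] by simp

text \<open>The shifted cube is cut along the hyperplane where the coordinate \<open>i\<close>
  equals 1. By periodicity the part that sticks out may be moved back by one unit, where it fills
  the slab that the shift has left empty.\<close>

lemma integral_cube_shift:
  fixes f :: "real ^ 'n \<Rightarrow> complex"
  assumes c: "continuous_on UNIV f" and p: "periodic f" and t: "0 \<le> t" "t \<le> 1"
  shows "integral (cbox 0 1) (\<lambda>x. f (x + t *\<^sub>R axis i 1)) = integral (cbox 0 1) f"
proof -
  let ?e = "axis i 1 :: real ^ 'n"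
  have io: "f integrable_on cbox a b" for a b
    by (rule integrable_continuous[OF continuous_on_subset[OF c]]) simp
  have e: "?e \<in> Basis"
    by (simp add: axis_in_Basis_iff)
  note split = integral_split[OF io e, unfolded inner_axis real_inner_1_right]
  have "integral (cbox 0 1) (\<lambda>x. f (x + t *\<^sub>R ?e)) = integral (cbox (t *\<^sub>R ?e) (1 + t *\<^sub>R ?e)) f"
    using integral_shift_cbox_plus[of 0 1 f "t *\<^sub>R ?e"] by (simp add: o_def add.commute)
  also have "\<dots> = integral (cbox (t *\<^sub>R ?e) (1 + t *\<^sub>R ?e) \<inter> {x. x $ i \<le> 1}) f
      + integral (cbox (t *\<^sub>R ?e) (1 + t *\<^sub>R ?e) \<inter> {x. x $ i \<ge> 1}) f"
    by (rule split)
  also have "cbox (t *\<^sub>R ?e) (1 + t *\<^sub>R ?e) \<inter> {x. x $ i \<le> 1} = cbox (t *\<^sub>R ?e) 1"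
    using t by (intro set_eqI, simp add: mem_box_cart axis_def) (smt (verit))
  also have "cbox (t *\<^sub>R ?e) (1 + t *\<^sub>R ?e) \<inter> {x. x $ i \<ge> 1} = cbox ?e (1 + t *\<^sub>R ?e)"
    using t by (intro set_eqI, simp add: mem_box_cart axis_def) (smt (verit))
  also have "integral (cbox ?e (1 + t *\<^sub>R ?e)) f = integral (cbox 0 (1 + t *\<^sub>R ?e - ?e)) f"
    using integral_shift_cbox_plus[of 0 "1 + t *\<^sub>R ?e - ?e" f ?e] periodic_shift_axis[OF p, of _ i]
    by (simp add: o_def add.commute)
  also have "cbox 0 (1 + t *\<^sub>R ?e - ?e) = cbox 0 1 \<inter> {x. x $ i \<le> t}"
    using t by (intro set_eqI, simp add: mem_box_cart axis_def) (smt (verit))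
  also have "cbox (t *\<^sub>R ?e) 1 = cbox 0 1 \<inter> {x. x $ i \<ge> t}"
    using t by (intro set_eqI, simp add: mem_box_cart axis_def) (smt (verit))
  finally show ?thesis
    using split[of 0 1 t] by (simp add: add.commute)
qed

text \<open>A relation rather than a function, so that existence of the derivative is part of the
  statement; \<open>pderivative\<close> has some value even where no derivative exists.\<close>

definition deriv_along :: "'n \<Rightarrow> (real ^ 'n \<Rightarrow> complex) \<Rightarrow> (real ^ 'n \<Rightarrow> complex) \<Rightarrow> bool"
  where "deriv_along i f f' \<longleftrightarrow>
    (\<forall>x. ((\<lambda>t. f (x + t *\<^sub>R axis i 1)) has_vector_derivative f' x) (at 0))"

lemma deriv_along_at:
  assumes "deriv_along i f f'"
  shows "((\<lambda>t. f (x + t *\<^sub>R axis i 1)) has_vector_derivative f' (x + t *\<^sub>R axis i 1)) (at t)"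
proof -
  have "((\<lambda>s. f ((x + t *\<^sub>R axis i 1) + s *\<^sub>R axis i 1)) has_vector_derivative f' (x + t *\<^sub>R axis i 1)) (at (t - t))"
    using assms by (simp add: deriv_along_def)
  then have "((\<lambda>s. f ((x + t *\<^sub>R axis i 1) + s *\<^sub>R axis i 1)) \<circ> (\<lambda>s. s - t)
      has_vector_derivative (1 *\<^sub>R f' (x + t *\<^sub>R axis i 1))) (at t)"
    by (intro vector_diff_chain_at) (auto intro!: derivative_eq_intros)
  then show ?thesis
    by (simp add: o_def algebra_simps)
qed

lemma deriv_along_mult:
  assumes "deriv_along i f f'" "deriv_along i g g'"
  shows "deriv_along i (\<lambda>x. f x * g x) (\<lambda>x. f' x * g x + f x * g' x)"
  unfolding deriv_along_def
proof
  fix x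
  have "((\<lambda>t. f (x + t *\<^sub>R axis i 1) * g (x + t *\<^sub>R axis i 1)) has_vector_derivative
    f (x + 0 *\<^sub>R axis i 1) * g' x + f' x * g (x + 0 *\<^sub>R axis i 1)) (at 0)"
    using assms by (intro has_vector_derivative_mult) (auto simp: deriv_along_def)
  then show "((\<lambda>t. f (x + t *\<^sub>R axis i 1) * g (x + t *\<^sub>R axis i 1)) has_vector_derivative
    f' x * g x + f x * g' x) (at 0)"
    by (simp add: add.commute)
qed

lemma deriv_along_add:
  assumes "deriv_along i f f'" "deriv_along i g g'"
  shows "deriv_along i (\<lambda>x. f x + g x) (\<lambda>x. f' x + g' x)"
  using assms unfolding deriv_along_def by (auto intro!: derivative_eq_intros)

lemma deriv_along_cmult:
  assumes "deriv_along i f f'"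
  shows "deriv_along i (\<lambda>x. c * f x) (\<lambda>x. c * f' x)"
  using assms unfolding deriv_along_def by (auto intro!: derivative_eq_intros)

lemma deriv_along_inverse:
  assumes "deriv_along i f f'" "\<And>x. f x \<noteq> 0"
  shows "deriv_along i (\<lambda>x. 1 / f x) (\<lambda>x. - (f' x * (1 / f x) * (1 / f x)))"
  unfolding deriv_along_def
proof
  fix x
  have "((\<lambda>z. 1 / z) has_field_derivative - (1 / f x) * (1 / f x)) (at (f (x + 0 *\<^sub>R axis i 1)))"
    using assms(2) by (auto intro!: derivative_eq_intros simp: power2_eq_square)
  moreover have "((\<lambda>t. f (x + t *\<^sub>R axis i 1)) has_vector_derivative f' x) (at 0)"
    using assms(1) by (simp add: deriv_along_def)
  ultimately have "((\<lambda>z. 1 / z) \<circ> (\<lambda>t. f (x + t *\<^sub>R axis i 1)) has_vector_derivative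
    f' x * (- (1 / f x) * (1 / f x))) (at 0)"
    by (intro field_vector_diff_chain_at)
  then show "((\<lambda>t. 1 / f (x + t *\<^sub>R axis i 1)) has_vector_derivative - (f' x * (1 / f x) * (1 / f x))) (at 0)"
    by (simp add: o_def)
qed

text \<open>The integral of a translate of \<open>f\<close> over the cube does not depend on the
  translation, and differentiating under the integral sign at translation zero gives the integral of
  \<open>f'\<close>.\<close>

lemma integral_deriv_along_eq_0:
  fixes f :: "real ^ 'n \<Rightarrow> complex"
  assumes f: "continuous_on UNIV f" "periodic f" and d: "deriv_along i f f'" and f': "continuous_on UNIV f'"
  shows "integral (cbox 0 1) f' = 0"
proof -
  let ?I = "\<lambda>t. integral (cbox 0 1) (\<lambda>x. f (x + t *\<^sub>R axis i 1))"
  have cont: "continuous_on S (\<lambda>x. f (x + t *\<^sub>R axis i 1))" for t S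
    by (rule continuous_on_compose2[OF f(1)]) (auto intro!: continuous_intros)
  have cont': "continuous_on S (\<lambda>(t, x). f' (x + t *\<^sub>R axis i 1))" for S
    unfolding case_prod_beta
    by (rule continuous_on_compose2[OF f']) (auto intro!: continuous_intros)
  have "(?I has_vector_derivative integral (cbox 0 1) (\<lambda>x. f' (x + 0 *\<^sub>R axis i 1))) (at 0 within {0..1})"
  proof (rule leibniz_rule_vector_derivative[OF _ _ cont'])
    show "((\<lambda>t. f (x + t *\<^sub>R axis i 1)) has_vector_derivative f' (x + t *\<^sub>R axis i 1)) (at t within {0..1})" for x t
      by (rule has_vector_derivative_at_within[OF deriv_along_at[OF d]])
    show "(\<lambda>x. f (x + t *\<^sub>R axis i 1)) integrable_on cbox 0 1" for t
      by (rule integrable_continuous[OF cont])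
  qed auto
  \<comment> \<open>Invariance is available for translations in \<open>{0..1}\<close> only, hence
    the one-sided derivative at 0.\<close>
  moreover have "(?I has_vector_derivative 0) (at 0 within {0..1})"
    by (rule has_vector_derivative_transform[where f = "\<lambda>_. integral (cbox 0 1) f"])
      (auto simp: integral_cube_shift f)
  ultimately show ?thesis
    using vector_derivative_unique_within_closed_interval[of 0 1 0 ?I] by fastforce
qed

section \<open>Characters and Fourier coefficients on the torus\<close>

definition character :: "int ^ 'n \<Rightarrow> real ^ 'n \<Rightarrow> complex"
  where "character p x = exp (2 * pi * \<i> * of_real (rvec p \<bullet> x))"

lemma character_eq_cis: "character p x = cis (2 * pi * (rvec p \<bullet> x))"
  by (simp add: character_def cis_conv_exp mult_ac)

lemma norm_character [simp]: "cmod (character p x) = 1"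
  by (simp add: character_eq_cis)

lemma character_0 [simp]: "character 0 x = 1"
  by (simp add: character_def)

lemma character_add: "character (p + q) x = character p x * character q x"
  by (simp add: character_eq_cis cis_mult inner_add_left algebra_simps)

lemma character_minus: "character (- p) x = exp (- 2 * pi * \<i> * of_real (rvec p \<bullet> x))"
  by (simp add: character_def)

lemma continuous_on_character [continuous_intros]: "continuous_on S (character p)"
  unfolding character_def by (intro continuous_intros)

lemma inner_rvec_rvec_int: "rvec p \<bullet> rvec l \<in> \<int>"
  by (auto simp: inner_vec_def intro!: Ints_sum Ints_mult)

lemma periodic_character: "periodic (character p)"
  unfolding periodic_def
proof safe
  fix l x
  obtain z where z: "rvec p \<bullet> rvec l = of_int z"
    using inner_rvec_rvec_int[of p l] Ints_cases by blast
  have "cis (2 * pi * of_int z) = 1"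
    using cis_multiple_2pi[of "of_int z"] by simp
  then show "character p (x + rvec l) = character p x"
    by (simp add: character_eq_cis inner_add_right distrib_left z flip: cis_mult)
qed

lemma deriv_along_character:
  fixes p :: "int ^ 'n"
  shows "deriv_along i (character p) (\<lambda>x. (2 * pi * \<i> * of_int (p $ i)) * character p x)"
  unfolding deriv_along_def
proof
  fix x :: "real ^ 'n"
  let ?g = "\<lambda>z::complex. exp (2 * of_real pi * \<i> * (of_real (rvec p \<bullet> x) + z * of_int (p $ i)))"
  have "(?g has_field_derivative (2 * pi * \<i> * of_int (p $ i)) * character p x) (at (of_real 0))"
    by (auto intro!: derivative_eq_intros simp: character_def)
  then have "((\<lambda>t. ?g (of_real t)) has_vector_derivative (2 * pi * \<i> * of_int (p $ i)) * character p x) (at 0)"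
    by (rule has_vector_derivative_real_field)
  then show "((\<lambda>t. character p (x + t *\<^sub>R axis i 1)) has_vector_derivative (2 * pi * \<i> * of_int (p $ i)) * character p x) (at 0)"
    by (simp add: character_def inner_add_right inner_axis)
qed

text \<open>With this sign, \<open>fcoef f p\<close> is the usual Fourier coefficient at
  \<open>- p\<close>. The choice makes \<open>fcoef (a k) (k - l)\<close> the matrix entry of the
  operator, and it is the reason for \<open>character (- p)\<close> in the inversion
  formula.\<close>

definition fcoef :: "(real ^ 'n \<Rightarrow> complex) \<Rightarrow> int ^ 'n \<Rightarrow> complex"
  where "fcoef f p = integral (cbox 0 1) (\<lambda>x. character p x * f x)"

lemma integrable_character_mult:
  assumes "continuous_on UNIV f"
  shows "(\<lambda>x. character p x * f x) integrable_on cbox a b"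
  by (intro integrable_continuous continuous_intros continuous_on_subset[OF assms]) auto

text \<open>Integration by parts: the derivative of the periodic function
  \<open>character p x * f x\<close> has integral zero, and the product rule splits it into the two
  coefficients.\<close>

lemma fcoef_deriv_along:
  assumes f: "continuous_on UNIV f" "periodic f" and d: "deriv_along i f f'" and f': "continuous_on UNIV f'"
  shows "fcoef f' p = - (2 * pi * \<i> * of_int (p $ i)) * fcoef f p"
proof -
  let ?c = "2 * pi * \<i> * of_int (p $ i)"
  have "integral (cbox 0 1) (\<lambda>x. (?c * character p x) * f x + character p x * f' x) = 0"
  proof (rule integral_deriv_along_eq_0)
    show "deriv_along i (\<lambda>x. character p x * f x) (\<lambda>x. (?c * character p x) * f x + character p x * f' x)"
      by (intro deriv_along_mult deriv_along_character d)
    show "periodic (\<lambda>x. character p x * f x)"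
      using f(2) periodic_character[of p] by (simp add: periodic_def)
  qed (intro continuous_intros f f')+
  also have "integral (cbox 0 1) (\<lambda>x. (?c * character p x) * f x + character p x * f' x)
      = integral (cbox 0 1) (\<lambda>x. ?c * (character p x * f x)) + integral (cbox 0 1) (\<lambda>x. character p x * f' x)"
    unfolding mult.assoc
    by (intro integral_add integrable_character_mult integrable_on_mult_right f f')
  finally show ?thesis
    unfolding fcoef_def integral_mult_right by (simp add: add_eq_0_iff algebra_simps)
qed

lemma content_unit_cube: "measure lborel (cbox 0 1 :: (real ^ 'n) set) = 1"
proof -
  have "(0 :: real ^ 'n) \<in> cbox 0 1"
    by (simp add: mem_box_cart)
  then have "cbox 0 (1 :: real ^ 'n) \<noteq> {}"
    by blast
  then show ?thesis
    by (simp add: content_cbox_if_cart)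
qed

text \<open>Orthogonality of the characters. The constant function has derivative zero, so
  integration by parts in a direction with \<open>p $ i \<noteq> 0\<close> forces the coefficient to
  vanish.\<close>

lemma fcoef_1: "fcoef (\<lambda>_. 1) p = (if p = 0 then 1 else 0)"
proof (cases "p = 0")
  case False
  then obtain i where i: "p $ i \<noteq> 0"
    by (auto simp: vec_eq_iff)
  have "periodic (\<lambda>_. 1)" "deriv_along i (\<lambda>_. 1) (\<lambda>_. 0)"
    by (simp_all add: periodic_def deriv_along_def)
  from fcoef_deriv_along[OF _ this, of p] i have "fcoef (\<lambda>_. 1) p = 0"
    by (simp add: fcoef_def)
  with False show ?thesis by simp
qed (simp add: fcoef_def content_unit_cube)

lemma fcoef_bound:
  assumes "continuous_on UNIV f" "\<And>x. cmod (f x) \<le> B"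
  shows "cmod (fcoef f p) \<le> B"
proof -
  have "B \<ge> 0"
    using assms(2)[of 0] norm_ge_zero order_trans by blast
  then have "cmod (fcoef f p) \<le> B * measure lborel (cbox 0 1 :: (real ^ 'a) set)"
    unfolding fcoef_def
    by (intro has_integral_bound[OF _ integrable_integral] integrable_character_mult assms) (auto simp: norm_mult assms)
  then show ?thesis
    by (simp add: content_unit_cube)
qed

text \<open>The summable majorant \<open>M\<close> makes the partial sums over finite sets converge
  uniformly (Weierstrass test), and uniform convergence carries both continuity and the integral to
  the limit.\<close>

lemma has_sum_integral_cbox:
  fixes f :: "'i \<Rightarrow> real ^ 'n \<Rightarrow> complex"
  assumes c: "\<And>i. continuous_on UNIV (f i)" and M: "M summable_on UNIV" "\<And>i x. cmod (f i x) \<le> M i"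
  shows "continuous_on UNIV (\<lambda>x. \<Sum>\<^sub>\<infinity>i. f i x)"
    and "((\<lambda>i. integral (cbox a b) (f i)) has_sum integral (cbox a b) (\<lambda>x. \<Sum>\<^sub>\<infinity>i. f i x)) UNIV"
proof -
  have u: "uniform_limit Y (\<lambda>F x. \<Sum>i\<in>F. f i x) (\<lambda>x. \<Sum>\<^sub>\<infinity>i. f i x) (finite_subsets_at_top UNIV)" for Y
    by (rule Weierstrass_m_test_general[OF M(2,1)])
  have cs: "continuous_on S (\<lambda>x. \<Sum>i\<in>F. f i x)" for F S
    by (intro continuous_intros continuous_on_subset[OF c]) auto
  show "continuous_on UNIV (\<lambda>x. \<Sum>\<^sub>\<infinity>i. f i x)"
    by (rule uniform_limit_theorem[OF _ u]) (auto intro: always_eventually cs)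
  obtain I J where I: "\<And>F. ((\<lambda>x. \<Sum>i\<in>F. f i x) has_integral I F) (cbox a b)"
    and J: "((\<lambda>x. \<Sum>\<^sub>\<infinity>i. f i x) has_integral J) (cbox a b)"
    and lim: "(I \<longlongrightarrow> J) (finite_subsets_at_top UNIV)"
    by (rule uniform_limit_integral_cbox[OF u cs, of a b]) auto
  have "I F = (\<Sum>i\<in>F. integral (cbox a b) (f i))" if "finite F" for F
    using has_integral_unique[OF I has_integral_sum[OF that integrable_integral]]
    by (auto intro!: integrable_continuous continuous_on_subset[OF c])
  then have "((\<lambda>F. \<Sum>i\<in>F. integral (cbox a b) (f i)) \<longlongrightarrow> J) (finite_subsets_at_top UNIV)"
    by (intro Lim_transform_eventually[OF lim] eventually_finite_subsets_at_top_weakI) auto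
  moreover have "J = integral (cbox a b) (\<lambda>x. \<Sum>\<^sub>\<infinity>i. f i x)"
    using J by (rule integral_unique[symmetric])
  ultimately show "((\<lambda>i. integral (cbox a b) (f i)) has_sum integral (cbox a b) (\<lambda>x. \<Sum>\<^sub>\<infinity>i. f i x)) UNIV"
    by (simp add: has_sum_def)
qed


subsection \<open>Fourier series\<close>

lemma fcoef_character_mult: "fcoef (\<lambda>x. character q x * f x) p = fcoef f (p + q)"
  by (simp add: fcoef_def character_add mult_ac)

lemma fcoef_cmult: "fcoef (\<lambda>x. c * f x) p = c * fcoef f p"
  unfolding fcoef_def integral_mult_right[symmetric] by (simp add: mult_ac)

lemma fcoef_add:
  assumes "continuous_on UNIV f" "continuous_on UNIV g"
  shows "fcoef (\<lambda>x. f x + g x) p = fcoef f p + fcoef g p"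
  unfolding fcoef_def distrib_left
  by (intro integral_add integrable_character_mult assms)

lemma fcoef_diff:
  assumes "continuous_on UNIV f" "continuous_on UNIV g"
  shows "fcoef (\<lambda>x. f x - g x) p = fcoef f p - fcoef g p"
  unfolding fcoef_def right_diff_distrib
  by (intro integral_diff integrable_character_mult assms)

text \<open>The powers of \<open>Q\<close> concentrate at its maximum point \<open>y\<close>.\<close>

lemma integral_power_peak_pos:
  fixes g Q :: "real ^ 'n \<Rightarrow> real"
  assumes g: "continuous_on UNIV g" "g y = 1" and y: "y \<in> box 0 1"
    and Q: "continuous_on UNIV Q" "Q y = 1" "\<And>x. 0 \<le> Q x" "\<And>x. x \<in> cbox 0 1 \<Longrightarrow> x \<noteq> y \<Longrightarrow> Q x < 1"
  shows "\<exists>N::nat. integral (cbox 0 1) (\<lambda>x. Q x ^ N * g x) > 0"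
proof -
  let ?S = "cbox 0 1 :: (real ^ 'n) set"
  define U where "U = {x. g x > 1/2}"
  have U: "open U" "y \<in> U"
  proof -
    show "open U"
      unfolding U_def by (intro open_Collect_less continuous_intros g)
  qed (simp add: U_def g)
  obtain q where q: "0 \<le> q" "q < 1" "\<And>x. x \<in> ?S - U \<Longrightarrow> Q x \<le> q"
  proof (cases "?S - U = {}")
    case True
    then show ?thesis by (intro that[of 0]) auto
  next
    case False
    have "compact (?S - U)"
      using U by (intro compact_diff) auto
    then obtain z where z: "z \<in> ?S - U" "\<forall>x\<in>?S - U. Q x \<le> Q z"
      using continuous_attains_sup[OF _ False continuous_on_subset[OF Q(1)]] by blast
    then have "z \<noteq> y"
      using U by blast
    then show ?thesis
      using z Q by (intro that[of "Q z"]) auto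
  qed
  \<comment> \<open>A level strictly between \<open>q\<close> and the maximum 1. The small box
    around \<open>y\<close> contributes at least a multiple of \<open>q' ^ N\<close>, the points
    outside \<open>U\<close> cost at most a multiple of \<open>q ^ N\<close>, and the rest of
    \<open>U\<close> contributes nonnegatively; the quotient \<open>(q / q') ^ N\<close> tends to
    zero.\<close>
  define q' where "q' = (1 + q) / 2"
  have q': "q < q'" "0 < q'" "q' < 1"
    using q by (auto simp: q'_def)
  define V where "V = {x. Q x > q'} \<inter> U \<inter> box 0 1"
  have "open V" "y \<in> V"
    unfolding V_def using Q q' U y by (auto intro!: open_Int open_Collect_less continuous_intros)
  then obtain a b where ab: "y \<in> box a b" "cbox a b \<subseteq> V"
    by (metis open_contains_cbox)
  have ab_S: "cbox a b \<subseteq> ?S"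
    using ab box_subset_cbox[of 0 "1 :: real ^ 'n"] by (auto simp: V_def)
  define c where "c = measure lborel (cbox a b)"
  have c: "c > 0"
    unfolding c_def using ab(1) by (auto simp: content_pos_lt_eq mem_box)
  obtain B where B: "B > 0" "\<And>x. x \<in> ?S \<Longrightarrow> \<bar>g x\<bar> \<le> B"
  proof -
    have "bounded (g ` ?S)"
      by (intro compact_imp_bounded compact_continuous_image continuous_on_subset[OF g(1)]) auto
    then show ?thesis
      using that unfolding bounded_pos by auto
  qed
  have "(\<lambda>N. (q / q') ^ N) \<longlonglongrightarrow> 0"
    using q q' by (intro LIMSEQ_power_zero) auto
  then have "\<forall>\<^sub>F N in sequentially. (q / q') ^ N < c / (2 * B)"
    by (rule order_tendstoD) (use c B in auto)
  then obtain N where N: "(q / q') ^ N < c / (2 * B)"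
    by (auto simp: eventually_sequentially)
  then have "B * q ^ N < q' ^ N / 2 * c"
    using q' B by (simp add: power_divide field_simps)
  moreover have "q' ^ N / 2 * c - B * q ^ N \<le> integral ?S (\<lambda>x. Q x ^ N * g x)"
  proof -
    let ?h = "\<lambda>x. (if x \<in> cbox a b then q' ^ N / 2 else 0) - B * q ^ N"
    have 1: "(\<lambda>x. if x \<in> cbox a b then q' ^ N / 2 else 0) integrable_on ?S"
      unfolding integrable_restrict_Int using ab_S integrable_const[of "q' ^ N / 2" a b]
      by (simp only: Int_absorb2)
    have "integral ?S ?h = integral ?S (\<lambda>x. if x \<in> cbox a b then q' ^ N / 2 else 0) - integral ?S (\<lambda>_. B * q ^ N)"
      by (rule integral_diff[OF 1]) auto
    also have "integral ?S (\<lambda>x. if x \<in> cbox a b then q' ^ N / 2 else 0) = q' ^ N / 2 * c"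
      unfolding integral_restrict_Int using ab_S by (simp add: Int_absorb1 Int_absorb2 c_def)
    also have "integral ?S (\<lambda>_. B * q ^ N) = B * q ^ N"
      by (simp add: content_unit_cube)
    finally have eq: "integral ?S ?h = q' ^ N / 2 * c - B * q ^ N" .
    have "integral ?S ?h \<le> integral ?S (\<lambda>x. Q x ^ N * g x)"
    proof (rule integral_le)
      show "?h integrable_on ?S"
        by (rule integrable_diff[OF 1]) auto
      show "(\<lambda>x. Q x ^ N * g x) integrable_on ?S"
        by (intro integrable_continuous continuous_intros continuous_on_subset[OF Q(1)] continuous_on_subset[OF g(1)]) auto
      fix x assume x: "x \<in> ?S"
      consider "x \<in> cbox a b" | "x \<notin> cbox a b" "x \<in> U" | "x \<notin> cbox a b" "x \<notin> U"
        by blast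
      then show "?h x \<le> Q x ^ N * g x"
      proof cases
        case 1
        then have "q' \<le> Q x" "1/2 \<le> g x"
          using ab by (auto simp: V_def U_def)
        then have "q' ^ N * (1/2) \<le> Q x ^ N * g x"
          using q' Q(3)[of x] by (intro mult_mono power_mono) auto
        moreover have "0 \<le> B * q ^ N"
          using B q by simp
        ultimately show ?thesis
          using 1 by simp
      next
        case 2
        then have "0 \<le> Q x ^ N * g x" "0 \<le> B * q ^ N"
          using Q(3)[of x] B q by (auto simp: U_def)
        then show ?thesis
          using 2 by simp
      next
        case 3
        then have "Q x ^ N * \<bar>g x\<bar> \<le> q ^ N * B"
          using q x B Q(3)[of x] by (intro mult_mono power_mono) auto
        moreover have "- (Q x ^ N * \<bar>g x\<bar>) \<le> Q x ^ N * g x"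
          using abs_ge_minus_self[of "Q x ^ N * g x"] Q(3)[of x] by (simp add: abs_mult)
        ultimately show ?thesis
          using 3 by (simp add: mult.commute)
      qed
    qed
    then show ?thesis
      by (simp add: eq)
  qed
  ultimately have "0 < integral ?S (\<lambda>x. Q x ^ N * g x)"
    by linarith
  then show ?thesis ..
qed

text \<open>If \<open>f\<close> is orthogonal to all characters, it is orthogonal to every
  trigonometric polynomial, in particular to all powers of one that peaks at a single point
  \<open>y\<close>. If \<open>f y\<close> were nonzero, these powers would detect it. Interior
  points come first, and continuity extends the conclusion to the closed cube.\<close>

lemma fcoef_zero_imp_zero:
  fixes f :: "real ^ 'n \<Rightarrow> complex"
  assumes f: "continuous_on UNIV f" and 0: "\<And>p. fcoef f p = 0" and x: "x \<in> cbox 0 1"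
  shows "f x = 0"
proof -
  have "f y = 0" if y: "y \<in> box 0 1" for y
  proof (rule ccontr)
    assume fy: "f y \<noteq> 0"
    let ?r = "\<lambda>j x. (1 + cos (2 * pi * (x $ j - y $ j))) / 2"
    define Q where "Q x = (\<Prod>j\<in>UNIV. ?r j x)" for x
    \<comment> \<open>\<open>Z P\<close> says that multiplication by \<open>P\<close> keeps all
      coefficients of \<open>f\<close> zero. It is preserved by each cosine factor, so it passes to
      all powers of \<open>Q\<close>.\<close>
    define Z where "Z P \<longleftrightarrow> continuous_on UNIV P \<and> (\<forall>p. fcoef (\<lambda>x. P x * f x) p = 0)" for P
    have Z1: "Z (\<lambda>_. 1)"
      using 0 by (simp add: Z_def)
    have Zr: "Z (\<lambda>x. of_real (?r j x) * P x)" if P: "Z P" for j P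
      unfolding Z_def
    proof (intro conjI allI)
      fix p
      let ?F = "\<lambda>x. P x * f x"
      let ?w = "cis (2 * pi * y $ j)"
      have cF: "continuous_on UNIV ?F"
        using P f by (auto simp: Z_def intro!: continuous_intros)
      \<comment> \<open>By Euler's formula the factor is a combination of the constant and two
        characters; multiplying by a character merely shifts the coefficients.\<close>
      have r: "of_real (?r j x) = 1/2 + (cnj ?w / 4 * character (axis j 1) x + ?w / 4 * character (- axis j 1) x)" for x
        by (simp add: character_eq_cis inner_axis' complex_eq_iff cos_diff algebra_simps)
          (simp add: field_simps)
      have "fcoef (\<lambda>x. of_real (?r j x) * ?F x) p
        = fcoef (\<lambda>x. 1/2 * ?F x + (cnj ?w / 4 * (character (axis j 1) x * ?F x) + ?w / 4 * (character (- axis j 1) x * ?F x))) p"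
        unfolding r by (simp add: algebra_simps)
      also have "\<dots> = 1/2 * fcoef ?F p + (cnj ?w / 4 * fcoef ?F (p + axis j 1) + ?w / 4 * fcoef ?F (p + - axis j 1))"
      proof -
        have c: "continuous_on UNIV (\<lambda>x. b * ?F x)" "continuous_on UNIV (\<lambda>x. b * (character q x * ?F x))"
          "continuous_on UNIV (\<lambda>x. b * (character q x * ?F x) + d * (character r x * ?F x))" for b d q r
          by (intro continuous_intros cF)+
        show ?thesis
          by (simp only: fcoef_add[OF c(1) c(3)] fcoef_add[OF c(2) c(2)] fcoef_cmult fcoef_character_mult)
      qed
      also have "\<dots> = 0"
        using P by (simp add: Z_def)
      finally show "fcoef (\<lambda>x. of_real (?r j x) * P x * f x) p = 0"
        by (simp add: mult.assoc)
    next
      show "continuous_on UNIV (\<lambda>x. of_real (?r j x) * P x)"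
        using P by (auto simp: Z_def intro!: continuous_intros)
    qed
    have Zprod: "Z (\<lambda>x. of_real (\<Prod>j\<in>J. ?r j x) * P x)" if P: "Z P" for J P
    proof (induction J rule: infinite_finite_induct)
      case (insert j J)
      then show ?case
        using Zr[OF insert.IH, of j] by (simp only: prod.insert[OF insert.hyps] of_real_mult mult.assoc)
    qed (use P in simp_all)
    have ZQ: "Z (\<lambda>x. of_real (Q x ^ N))" for N
    proof (induction N)
      case (Suc N)
      from Zprod[OF Suc, of UNIV] show ?case
        by (simp add: Q_def)
    qed (use Z1 in simp)
    have cQ: "continuous_on S Q" for S
      unfolding Q_def by (intro continuous_intros) auto
    have "\<exists>N::nat. integral (cbox 0 1) (\<lambda>x. Q x ^ N * Re (f x / f y)) > 0"
    proof (rule integral_power_peak_pos[OF _ _ y cQ])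
      show "continuous_on UNIV (\<lambda>x. Re (f x / f y))"
        using f fy by (intro continuous_intros) auto
      have r01: "0 \<le> ?r j x" "?r j x \<le> 1" for j x
        using cos_ge_minus_one[of "2 * pi * (x $ j - y $ j)"] cos_le_one[of "2 * pi * (x $ j - y $ j)"]
        by (auto simp del: cos_ge_minus_one cos_le_one)
      show "0 \<le> Q x" for x
        unfolding Q_def by (intro prod_nonneg r01 ballI)
      fix x :: "real ^ 'n" assume x: "x \<in> cbox 0 1" "x \<noteq> y"
      then obtain j where j: "x $ j \<noteq> y $ j"
        by (auto simp: vec_eq_iff)
      \<comment> \<open>Here \<open>y\<close> has to be interior: for \<open>y\<close> on a face,
        the opposite face of the closed cube would hold a second maximum of
        \<open>Q\<close>.\<close>
      have "\<bar>x $ j - y $ j\<bar> < 1"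
        using x(1) y by (simp add: mem_box_cart) (smt (verit))
      moreover have "x $ j - y $ j \<noteq> 0"
        using j by simp
      ultimately have "\<not> (\<exists>n::int. x $ j - y $ j = of_int n)"
        by (metis abs_ge_zero of_int_0 of_int_1 of_int_abs of_int_less_iff int_one_le_iff_zero_less linorder_not_less zero_less_abs_iff)
      then have "cos (2 * pi * (x $ j - y $ j)) \<noteq> 1"
        by (auto simp: cos_one_2pi_int)
      then have rj: "?r j x < 1"
        by (simp add: less_le)
      have "Q x = ?r j x * (\<Prod>i\<in>UNIV - {j}. ?r i x)"
        unfolding Q_def by (rule prod.remove) auto
      also have "\<dots> \<le> ?r j x * 1"
        by (intro mult_left_mono prod_le_1) (use r01 in auto)
      finally show "Q x < 1"
        using rj by simp
    qed (use fy in \<open>auto simp: Q_def\<close>)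
    then obtain N where N: "integral (cbox 0 1) (\<lambda>x. Q x ^ N * Re (f x / f y)) > 0" ..
    have "integral (cbox 0 1) (\<lambda>x. of_real (Q x ^ N) * f x) = 0"
      using ZQ[of N] by (auto simp: Z_def fcoef_def dest: spec[of _ 0])
    moreover have "(\<lambda>x. of_real (Q x ^ N) * f x) integrable_on cbox 0 1"
      by (intro integrable_continuous continuous_intros cQ continuous_on_subset[OF f]) auto
    ultimately have "((\<lambda>x. of_real (Q x ^ N) * f x) has_integral 0) (cbox 0 1)"
      by (metis integrable_integral)
    then have "((\<lambda>x. of_real (Q x ^ N) * f x * (1 / f y)) has_integral 0 * (1 / f y)) (cbox 0 1)"
      by (rule has_integral_mult_left)
    then have "((\<lambda>x. Re (of_real (Q x ^ N) * f x * (1 / f y))) has_integral Re 0) (cbox 0 1)"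
      by (intro has_integral_Re) simp
    moreover have "Re (of_real (Q x ^ N) * f x * (1 / f y)) = Q x ^ N * Re (f x / f y)" for x
    proof -
      have "of_real (Q x ^ N) * f x * (1 / f y) = of_real (Q x ^ N) * (f x / f y)"
        by simp
      then show ?thesis
        by (simp only: times_complex.sel Re_complex_of_real Im_complex_of_real mult_zero_left diff_0_right)
    qed
    ultimately have "integral (cbox 0 1) (\<lambda>x. Q x ^ N * Re (f x / f y)) = 0"
      by (simp add: integral_unique)
    with N show False by simp
  qed
  moreover have "closure (box 0 1) = (cbox 0 1 :: (real ^ 'n) set)"
  proof (rule closure_box)
    have "(\<chi> i. 1/2) \<in> (box 0 1 :: (real ^ 'n) set)"
      by (simp add: mem_box_cart)
    then show "box 0 (1 :: real ^ 'n) \<noteq> {}" by blast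
  qed
  ultimately show ?thesis
    using continuous_constant_on_closure[of "box 0 1" f 0 x, OF continuous_on_subset[OF f]] x by simp
qed

text \<open>The series converges uniformly, so its coefficients may be computed term by term and
  agree with those of \<open>f\<close>; the difference then vanishes by uniqueness.\<close>

lemma fourier_inversion:
  fixes f :: "real ^ 'n \<Rightarrow> complex"
  assumes f: "continuous_on UNIV f" and s: "(\<lambda>p. cmod (fcoef f p)) summable_on UNIV" and x: "x \<in> cbox 0 1"
  shows "(\<Sum>\<^sub>\<infinity>p. fcoef f p * character (- p) x) = f x"
proof -
  let ?h = "\<lambda>x. \<Sum>\<^sub>\<infinity>p. fcoef f p * character (- p) x"
  have h: "continuous_on UNIV ?h"
    by (rule has_sum_integral_cbox[OF _ s]) (auto simp: norm_mult intro!: continuous_intros)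
  have "fcoef ?h q = fcoef f q" for q
  proof -
    have "((\<lambda>p. integral (cbox 0 1) (\<lambda>x. fcoef f p * character (q - p) x)) has_sum
        integral (cbox 0 1) (\<lambda>x. \<Sum>\<^sub>\<infinity>p. fcoef f p * character (q - p) x)) UNIV"
      by (rule has_sum_integral_cbox[OF _ s]) (auto simp: norm_mult intro!: continuous_intros)
    moreover have "integral (cbox 0 1) (\<lambda>x. fcoef f p * character (q - p) x) = (if p = q then fcoef f q else 0)" for p
      using fcoef_1[of "q - p"] by (auto simp: fcoef_def)
    moreover have "(\<Sum>\<^sub>\<infinity>p. fcoef f p * character (q - p) x) = character q x * ?h x" for x
      using character_add[of q "- p" x for p] by (simp add: mult_ac flip: infsum_cmult_right')
    ultimately have "((\<lambda>p. if p = q then fcoef f q else 0) has_sum fcoef ?h q) UNIV"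
      by (simp add: fcoef_def)
    moreover have "((\<lambda>p. if p = q then fcoef f q else 0) has_sum fcoef f q) UNIV"
      by (rule has_sum_finite_neutralI[of "{q}"]) auto
    ultimately show ?thesis
      by (rule has_sum_unique)
  qed
  then have "fcoef (\<lambda>x. ?h x - f x) q = 0" for q
    by (simp add: fcoef_diff[OF h f])
  from fcoef_zero_imp_zero[OF _ this x] h f show ?thesis
    by (simp add: continuous_intros)
qed

text \<open>The convolution theorem, by integrating the Fourier series of \<open>f\<close> term by
  term. Applied to a symbol and its reciprocal, it produces the convolution inverse.\<close>

lemma fcoef_mult:
  fixes f g :: "real ^ 'n \<Rightarrow> complex"
  assumes f: "continuous_on UNIV f" and s: "(\<lambda>p. cmod (fcoef f p)) summable_on UNIV"
    and g: "continuous_on UNIV g" "\<And>x. cmod (g x) \<le> B"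
  shows "((\<lambda>p. fcoef f p * fcoef g (q - p)) has_sum fcoef (\<lambda>x. g x * f x) q) UNIV"
proof -
  have "((\<lambda>p. integral (cbox 0 1) (\<lambda>x. fcoef f p * (character (q - p) x * g x))) has_sum
      integral (cbox 0 1) (\<lambda>x. \<Sum>\<^sub>\<infinity>p. fcoef f p * (character (q - p) x * g x))) UNIV"
    by (rule has_sum_integral_cbox[OF _ summable_on_cmult_left[OF s, of B]])
      (auto simp: norm_mult intro!: continuous_intros g mult_left_mono)
  also have "integral (cbox 0 1) (\<lambda>x. \<Sum>\<^sub>\<infinity>p. fcoef f p * (character (q - p) x * g x)) = fcoef (\<lambda>x. g x * f x) q"
    unfolding fcoef_def[of "\<lambda>x. g x * f x"]
  proof (rule integral_cong)
    fix x assume x: "x \<in> cbox 0 (1 :: real ^ 'n)"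
    have "(\<Sum>\<^sub>\<infinity>p. fcoef f p * (character (q - p) x * g x)) = (character q x * g x) * (\<Sum>\<^sub>\<infinity>p. fcoef f p * character (- p) x)"
      using character_add[of q "- p" x for p] by (simp add: mult_ac flip: infsum_cmult_right')
    then show "(\<Sum>\<^sub>\<infinity>p. fcoef f p * (character (q - p) x * g x)) = character q x * (g x * f x)"
      by (simp add: fourier_inversion[OF f s x])
  qed
  finally show ?thesis
    by (simp add: fcoef_def)
qed


subsection \<open>Symbols\<close>

definition dominated :: "('k \<Rightarrow> real) \<Rightarrow> ('k \<Rightarrow> real ^ 'n \<Rightarrow> complex) \<Rightarrow> bool"
  where "dominated W F \<longleftrightarrow>
    (\<forall>k. continuous_on UNIV (F k) \<and> periodic (F k)) \<and> (\<exists>C. \<forall>k x. cmod (F k x) \<le> C * W k)"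

text \<open>Up to \<open>N\<close> derivatives in the single direction \<open>i\<close>, all bounded
  by the same weight uniformly in the index. One direction at a time is enough for decay of Fourier
  coefficients, since the largest coordinate of \<open>p\<close> controls |p|; mixed derivatives
  never arise. Quantifying over \<open>F'\<close> lets the product and quotient rules supply the
  derivative directly.\<close>

primrec tame :: "'n \<Rightarrow> nat \<Rightarrow> ('k \<Rightarrow> real) \<Rightarrow> ('k \<Rightarrow> real ^ 'n \<Rightarrow> complex) \<Rightarrow> bool"
  where
    "tame i 0 W F \<longleftrightarrow> dominated W F"
  | "tame i (Suc N) W F \<longleftrightarrow> dominated W F \<and> (\<exists>F'. (\<forall>k. deriv_along i (F k) (F' k)) \<and> tame i N W F')"

lemma tame_SucI:
  "dominated W F \<Longrightarrow> (\<And>k. deriv_along i (F k) (F' k)) \<Longrightarrow> tame i N W F' \<Longrightarrow> tame i (Suc N) W F"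
  by auto

lemma tame_imp_dominated: "tame i N W F \<Longrightarrow> dominated W F"
  by (cases N) auto

lemma tame_Suc_imp_tame: "tame i (Suc N) W F \<Longrightarrow> tame i N W F"
proof (induction N arbitrary: F)
  case (Suc N)
  from Suc.prems obtain F' where "dominated W F" "\<forall>k. deriv_along i (F k) (F' k)" "tame i (Suc N) W F'"
    by auto
  with Suc.IH[of F'] show ?case by auto
qed auto

lemma dominated_mult:
  assumes "dominated V F" "dominated W G"
  shows "dominated (\<lambda>k. V k * W k) (\<lambda>k x. F k x * G k x)"
proof -
  obtain C D where C: "\<And>k x. cmod (F k x) \<le> C * V k" and D: "\<And>k x. cmod (G k x) \<le> D * W k"
    using assms by (auto simp: dominated_def)
  have "cmod (F k x * G k x) \<le> (C * D) * (V k * W k)" for k x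
    using mult_mono'[OF C D, of k x k x] by (simp add: norm_mult mult_ac)
  then show ?thesis
    using assms unfolding dominated_def by (auto simp: periodic_def intro!: continuous_intros)
qed

lemma dominated_add:
  assumes "dominated W F" "dominated W G"
  shows "dominated W (\<lambda>k x. F k x + G k x)"
proof -
  obtain C D where C: "\<And>k x. cmod (F k x) \<le> C * W k" and D: "\<And>k x. cmod (G k x) \<le> D * W k"
    using assms by (auto simp: dominated_def)
  have "cmod (F k x + G k x) \<le> (C + D) * W k" for k x
    using norm_triangle_le[OF add_mono[OF C D]] by (simp add: distrib_right)
  then show ?thesis
    using assms unfolding dominated_def by (auto simp: periodic_def intro!: continuous_intros)
qed

lemma dominated_cmult:
  assumes "dominated W F"
  shows "dominated W (\<lambda>k x. c * F k x)"
proof -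
  obtain C where C: "\<And>k x. cmod (F k x) \<le> C * W k"
    using assms by (auto simp: dominated_def)
  have "cmod (c * F k x) \<le> (cmod c * C) * W k" for k x
    using mult_left_mono[OF C[of k x], of "cmod c"] by (simp add: norm_mult mult_ac)
  then show ?thesis
    using assms unfolding dominated_def by (auto simp: periodic_def intro!: continuous_intros)
qed

lemma tame_add: "tame i N W F \<Longrightarrow> tame i N W G \<Longrightarrow> tame i N W (\<lambda>k x. F k x + G k x)"
proof (induction N arbitrary: F G)
  case (Suc N)
  obtain F' where F': "\<forall>k. deriv_along i (F k) (F' k)" "tame i N W F'"
    using Suc.prems by auto
  obtain G' where G': "\<forall>k. deriv_along i (G k) (G' k)" "tame i N W G'"
    using Suc.prems by auto
  have "\<forall>k. deriv_along i (\<lambda>x. F k x + G k x) (\<lambda>x. F' k x + G' k x)"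
    using F' G' by (auto intro: deriv_along_add)
  with Suc.IH[OF F'(2) G'(2)] Suc.prems show ?case
    by (auto intro: dominated_add)
qed (auto intro: dominated_add)

lemma tame_cmult: "tame i N W F \<Longrightarrow> tame i N W (\<lambda>k x. c * F k x)"
proof (induction N arbitrary: F)
  case (Suc N)
  obtain F' where F': "\<forall>k. deriv_along i (F k) (F' k)" "tame i N W F'"
    using Suc.prems by auto
  have "\<forall>k. deriv_along i (\<lambda>x. c * F k x) (\<lambda>x. c * F' k x)"
    using F' by (auto intro: deriv_along_cmult)
  with Suc.IH[OF F'(2)] Suc.prems show ?case
    by (auto intro: dominated_cmult)
qed (auto intro: dominated_cmult)

lemma tame_mult: "tame i N V F \<Longrightarrow> tame i N W G \<Longrightarrow> tame i N (\<lambda>k. V k * W k) (\<lambda>k x. F k x * G k x)"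
proof (induction N arbitrary: F G)
  case (Suc N)
  obtain F' where F': "\<forall>k. deriv_along i (F k) (F' k)" "tame i N V F'"
    using Suc.prems by auto
  obtain G' where G': "\<forall>k. deriv_along i (G k) (G' k)" "tame i N W G'"
    using Suc.prems by auto
  have "\<forall>k. deriv_along i (\<lambda>x. F k x * G k x) (\<lambda>x. F' k x * G k x + F k x * G' k x)"
    using F' G' by (auto intro: deriv_along_mult)
  moreover have "tame i N (\<lambda>k. V k * W k) (\<lambda>k x. F' k x * G k x + F k x * G' k x)"
    by (rule tame_add[OF Suc.IH[OF F'(2) tame_Suc_imp_tame[OF Suc.prems(2)]]
          Suc.IH[OF tame_Suc_imp_tame[OF Suc.prems(1)] G'(2)]])
  ultimately show ?case
    using Suc.prems by (auto intro: dominated_mult)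
qed (auto intro: dominated_mult)

text \<open>The derivative of \<open>1 / F\<close> is \<open>- F' \<cdot> (1 / F) \<cdot> (1 / F)\<close>, so that induction over the order applies.\<close>

lemma tame_inverse:
  fixes F :: "'k \<Rightarrow> real ^ 'n \<Rightarrow> complex"
  assumes F: "tame i N W F" and W: "\<And>k. W k > 0"
    and c: "c > 0" "\<And>k x. k \<in> E \<Longrightarrow> c * W k \<le> cmod (F k x)"
  shows "tame i N (\<lambda>k. 1 / W k) (\<lambda>k x. if k \<in> E then 1 / F k x else 0)"
proof -
  let ?G = "\<lambda>k x. if k \<in> E then 1 / F k x else 0"
  have nz: "F k x \<noteq> 0" if "k \<in> E" for k x
  proof -
    have "0 < c * W k"
      using c W by simp
    then show ?thesis
      using c(2)[OF that, of x] by auto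
  qed
  have dom: "dominated (\<lambda>k. 1 / W k) ?G"
    unfolding dominated_def
  proof (intro conjI allI exI)
    fix k x
    show "continuous_on UNIV (?G k)" "periodic (?G k)"
      using tame_imp_dominated[OF F] nz
      by (cases "k \<in> E"; auto simp: dominated_def periodic_def intro!: continuous_intros)+
    have "1 / cmod (F k x) \<le> 1 / (c * W k)" if "k \<in> E"
      using c W that by (intro divide_left_mono mult_pos_pos) (auto simp: nz)
    then show "cmod (?G k x) \<le> (1 / c) * (1 / W k)"
      using c W[of k] by (auto simp: norm_divide less_imp_le)
  qed
  from F show ?thesis
  proof (induction N)
    case (Suc N)
    obtain F' where F': "\<forall>k. deriv_along i (F k) (F' k)" "tame i N W F'"
      using Suc.prems by auto
    have G: "tame i N (\<lambda>k. 1 / W k) ?G"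
      using Suc tame_Suc_imp_tame by blast
    \<comment> \<open>The weight of the derivative collapses to \<open>1 / W k\<close> again: taking
      derivatives does not worsen the order of the reciprocal.\<close>
    have "tame i N (\<lambda>k. W k * (1 / W k) * (1 / W k)) (\<lambda>k x. - 1 * (F' k x * ?G k x * ?G k x))"
      by (intro tame_cmult tame_mult F' G)
    moreover have "W k \<noteq> 0" for k
      using W[of k] by simp
    ultimately have "tame i N (\<lambda>k. 1 / W k) (\<lambda>k x. - 1 * (F' k x * ?G k x * ?G k x))"
      by simp
    moreover have "deriv_along i (?G k) (\<lambda>x. - 1 * (F' k x * ?G k x * ?G k x))" for k
    proof (cases "k \<in> E")
      case True
      then show ?thesis
        using deriv_along_inverse[of i "F k" "F' k"] F'(1) nz by simp
    qed (simp add: deriv_along_def)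
    ultimately show ?case
      by (intro tame_SucI[OF dom])
  qed (use dom in simp)
qed

text \<open>Each derivative is traded for one factor \<open>p $ i\<close> by integration by parts;
  the bound on \<open>F\<close> itself handles order zero.\<close>

lemma tame_fcoef:
  fixes F :: "'k \<Rightarrow> real ^ 'n \<Rightarrow> complex"
  shows "tame i N W F \<Longrightarrow> \<exists>C. \<forall>k p. \<bar>of_int (p $ i)\<bar> ^ N * cmod (fcoef (F k) p) \<le> C * W k"
proof (induction N arbitrary: F)
  case 0
  then obtain C where C: "\<forall>k x. cmod (F k x) \<le> C * W k" and c: "\<And>k. continuous_on UNIV (F k)"
    by (auto simp: dominated_def)
  have "cmod (fcoef (F k) p) \<le> C * W k" for k p
    by (rule fcoef_bound[OF c]) (use C in auto)
  then show ?case by auto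
next
  case (Suc N)
  obtain F' where F': "\<And>k. deriv_along i (F k) (F' k)" "tame i N W F'"
    using Suc.prems by auto
  obtain C where C: "\<And>k p. \<bar>of_int (p $ i)\<bar> ^ N * cmod (fcoef (F' k) p) \<le> C * W k"
    using Suc.IH[OF F'(2)] by blast
  have "\<bar>of_int (p $ i)\<bar> ^ Suc N * cmod (fcoef (F k) p) \<le> C / (2 * pi) * W k" for k p
  proof -
    have "fcoef (F' k) p = - (2 * pi * \<i> * of_int (p $ i)) * fcoef (F k) p"
      using tame_imp_dominated[OF Suc.prems] tame_imp_dominated[OF F'(2)] F'(1)
      by (intro fcoef_deriv_along) (auto simp: dominated_def)
    then have "cmod (fcoef (F' k) p) = 2 * pi * \<bar>of_int (p $ i)\<bar> * cmod (fcoef (F k) p)"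
      by (simp add: norm_mult)
    with C[where p = p and k = k] show ?thesis
      by (simp add: field_simps)
  qed
  then show ?case by blast
qed

text \<open>Take a coordinate \<open>i\<close> of largest modulus, so that |p| is at most the
  dimension times the modulus of \<open>p $ i\<close>. If this coordinate is zero, then
  \<open>p = 0\<close> and the left side is 1; otherwise it is at least 1 and absorbs the summand 1
  of the bracket.\<close>

lemma bracket_power_le: "bracket p ^ N \<le> (1 + real CARD('n)) ^ N * (1 + (\<Sum>i\<in>UNIV. \<bar>of_int (p $ i)\<bar> ^ N))"
  for p :: "int ^ 'n"
proof -
  define M where "M = Max (range (\<lambda>i. \<bar>p $ i\<bar>))"
  have "M \<in> range (\<lambda>i. \<bar>p $ i\<bar>)"
    unfolding M_def by (rule Max_in) auto
  then obtain i where i: "M = \<bar>p $ i\<bar>"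
    by auto
  have le: "\<bar>p $ j\<bar> \<le> \<bar>p $ i\<bar>" for j
    unfolding i[symmetric] M_def by (rule Max_ge) auto
  have le': "\<bar>of_int (p $ j)\<bar> \<le> (\<bar>of_int (p $ i)\<bar> :: real)" for j
    using le[of j] by linarith
  have "norm (rvec p) \<le> (\<Sum>j\<in>UNIV. \<bar>rvec p $ j\<bar>)"
    by (rule norm_le_l1_cart)
  also have "\<dots> \<le> (\<Sum>j\<in>(UNIV :: 'n set). \<bar>of_int (p $ i)\<bar>)"
    using le' by (intro sum_mono) auto
  finally have bracket: "bracket p \<le> 1 + CARD('n) * \<bar>of_int (p $ i)\<bar>"
    by (simp add: bracket_def)
  have "bracket p ^ N \<le> (1 + real CARD('n)) ^ N * (1 + \<bar>of_int (p $ i)\<bar> ^ N)"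
  proof (cases "p $ i = 0")
    case True
    then have "bracket p ^ N \<le> 1 ^ N"
      using bracket by (intro power_mono) auto
    also have "\<dots> \<le> (1 + real CARD('n)) ^ N * (1 + \<bar>of_int (p $ i)\<bar> ^ N)"
      using mult_mono[of 1 "(1 + real CARD('n)) ^ N" 1 "1 + \<bar>of_int (p $ i)\<bar> ^ N"]
      by (simp add: one_le_power)
    finally show ?thesis .
  next
    case False
    then have "1 \<le> (\<bar>of_int (p $ i)\<bar> :: real)"
      by linarith
    then have "bracket p \<le> (1 + real CARD('n)) * \<bar>of_int (p $ i)\<bar>"
      using bracket by (simp add: distrib_right)
    then have "bracket p ^ N \<le> ((1 + real CARD('n)) * \<bar>of_int (p $ i)\<bar>) ^ N"
      by (intro power_mono) auto
    also have "\<dots> \<le> (1 + real CARD('n)) ^ N * (1 + \<bar>of_int (p $ i)\<bar> ^ N)"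
      by (simp add: power_mult_distrib)
    finally show ?thesis .
  qed
  also have "\<dots> \<le> (1 + real CARD('n)) ^ N * (1 + (\<Sum>i\<in>UNIV. \<bar>of_int (p $ i)\<bar> ^ N))"
    by (intro mult_left_mono add_left_mono member_le_sum) auto
  finally show ?thesis .
qed

lemma bracket_power_le_bound:
  fixes p :: "int ^ 'n"
  assumes "X \<le> D" "\<And>i. \<bar>of_int (p $ i)\<bar> ^ N * X \<le> C i" "0 \<le> X"
  shows "bracket p ^ N * X \<le> (1 + real CARD('n)) ^ N * (D + (\<Sum>i\<in>UNIV. C i))"
proof -
  have "bracket p ^ N * X \<le> ((1 + real CARD('n)) ^ N * (1 + (\<Sum>i\<in>UNIV. \<bar>of_int (p $ i)\<bar> ^ N))) * X"
    by (intro mult_right_mono bracket_power_le assms)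
  also have "\<dots> = (1 + real CARD('n)) ^ N * (X + (\<Sum>i\<in>UNIV. \<bar>of_int (p $ i)\<bar> ^ N * X))"
    by (simp add: algebra_simps sum_distrib_left)
  also have "\<dots> \<le> (1 + real CARD('n)) ^ N * (D + (\<Sum>i\<in>UNIV. C i))"
    using assms by (intro mult_left_mono add_mono sum_mono) auto
  finally show ?thesis .
qed

lemma tame_fcoef_decay:
  fixes F :: "'k \<Rightarrow> real ^ 'n \<Rightarrow> complex"
  assumes F: "\<And>i N. tame i N W F"
  shows "\<exists>C. \<forall>k p. cmod (fcoef (F k) p) \<le> C * W k / bracket p ^ N"
proof -
  obtain D where D: "\<And>k p. cmod (fcoef (F k) p) \<le> D * W k"
    using tame_fcoef[OF F, of _ 0] by auto
  obtain C where C: "\<And>i k p. \<bar>of_int (p $ i)\<bar> ^ N * cmod (fcoef (F k) p) \<le> C i * W k"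
    using tame_fcoef[OF F, of _ N] by metis
  have "bracket p ^ N * cmod (fcoef (F k) p) \<le> ((1 + real CARD('n)) ^ N * (D + (\<Sum>i\<in>UNIV. C i))) * W k" for k p
    using bracket_power_le_bound[OF D C] by (simp add: sum_distrib_right[symmetric] distrib_right[symmetric] mult.assoc)
  then have "cmod (fcoef (F k) p) \<le> ((1 + real CARD('n)) ^ N * (D + (\<Sum>i\<in>UNIV. C i))) * W k / bracket p ^ N" for k p
    by (simp add: pos_le_divide_eq mult.commute)
  then show ?thesis by blast
qed

section \<open>From symbol estimates to tame families\<close>

lemma smooth_imp_continuous: "smooth f \<Longrightarrow> continuous_on UNIV f"
  unfolding smooth_def by (drule spec[of _ "[]"]) simp

lemma smooth_imp_deriv_along: "smooth f \<Longrightarrow> deriv_along i f (pderivative i f)"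
  unfolding smooth_def deriv_along_def pderivative_def
  by (drule spec[of _ "[]"]) (simp add: vector_derivative_works)

lemma smooth_foldr: "smooth f \<Longrightarrow> smooth (foldr pderivative js f)"
  unfolding smooth_def by (metis foldr_append)

lemma deriv_along_pderivative: "deriv_along i f f' \<Longrightarrow> pderivative i f = f'"
  by (auto simp: deriv_along_def pderivative_def vector_derivative_at)

text \<open>The function \<open>pderivative\<close> can be trusted to be linear only where the
  derivatives exist; smoothness provides this for all iterates.\<close>

lemma foldr_pderivative_linear:
  assumes "smooth f" "smooth g"
  shows "foldr pderivative js (\<lambda>x. c * f x + d * g x)
    = (\<lambda>x. c * foldr pderivative js f x + d * foldr pderivative js g x)"
proof (induction js)
  case (Cons j js)
  have "deriv_along j (\<lambda>x. c * foldr pderivative js f x + d * foldr pderivative js g x)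
    (\<lambda>x. c * pderivative j (foldr pderivative js f) x + d * pderivative j (foldr pderivative js g) x)"
    by (intro deriv_along_add deriv_along_cmult smooth_imp_deriv_along smooth_foldr assms)
  from deriv_along_pderivative[OF this] Cons show ?case
    by simp
qed simp

lemma smooth_linear:
  assumes "smooth f" "smooth g"
  shows "smooth (\<lambda>x. c * f x + d * g x)"
  unfolding smooth_def foldr_pderivative_linear[OF assms]
  using assms unfolding smooth_def by (auto intro!: continuous_intros derivative_intros)

lemma periodic_pderivative: "periodic f \<Longrightarrow> periodic (pderivative i f)"
proof -
  assume f: "periodic f"
  have "f (x + rvec l + v) = f (x + v)" for x l v
    using periodicD[OF f, of "x + v" l] by (simp add: add_ac)
  then show "periodic (pderivative i f)"
    unfolding periodic_def pderivative_def by simp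
qed

lemma smooth_periodic_falling_D:
  assumes "smooth f" "periodic f"
  shows "smooth (falling_D i l f)" "periodic (falling_D i l f)"
proof (induction l)
  case (Suc l)
  {
    case 1
    have "smooth (pderivative i (falling_D i l f))"
      using smooth_foldr[OF Suc(1), of "[i]"] by simp
    from smooth_linear[OF this Suc(1), of "1 / (2 * of_real pi * \<i>)" "- of_nat l"] show ?case
      by simp
  next
    case 2
    show ?case
      using periodic_pderivative[OF Suc(2), of i] Suc(2) by (simp add: periodic_def)
  }
qed (use assms in auto)

text \<open>Symbol estimates concern the falling factorial operators, integration by parts needs
  ordinary derivatives. Solving the recursion for the derivative of \<open>falling_D i l\<close>
  gives a combination of \<open>falling_D i (Suc l)\<close> and \<open>falling_D i l\<close>, so
  induction over \<open>N\<close> works when it covers all \<open>l\<close> at once.\<close>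

lemma tame_if_falling_D_bounds:
  assumes F: "\<And>k. smooth (F k)" "\<And>k. periodic (F k)"
    and b: "\<And>l. \<exists>C. \<forall>k x. cmod (falling_D i l (F k) x) \<le> C * W k"
  shows "tame i N W F"
proof -
  have dom: "dominated W (\<lambda>k. falling_D i l (F k))" for l
    unfolding dominated_def using smooth_periodic_falling_D[OF F] b smooth_imp_continuous by metis
  have "tame i N W (\<lambda>k. falling_D i l (F k))" for l
  proof (induction N arbitrary: l)
    case (Suc N)
    have "pderivative i (falling_D i l (F k)) = (\<lambda>x. 2 * of_real pi * \<i> *
      (falling_D i (Suc l) (F k) x + of_nat l * falling_D i l (F k) x))" for k
      by (simp add: fun_eq_iff)
    then have "deriv_along i (falling_D i l (F k)) (\<lambda>x. 2 * of_real pi * \<i> *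
      (falling_D i (Suc l) (F k) x + of_nat l * falling_D i l (F k) x))" for k
      using smooth_imp_deriv_along[OF smooth_periodic_falling_D(1)[OF F]] by metis
    moreover have "tame i N W (\<lambda>k x. 2 * of_real pi * \<i> *
      (falling_D i (Suc l) (F k) x + of_nat l * falling_D i l (F k) x))"
      by (intro tame_cmult tame_add Suc.IH)
    ultimately show ?case
      by (intro tame_SucI[OF dom])
  qed (simp add: dom)
  from this[of 0] show ?thesis by simp
qed

lemma foldr_coord_single:
  fixes g :: "'n::finite \<Rightarrow> 'b \<Rightarrow> 'b"
  assumes "\<And>j. j \<noteq> i \<Longrightarrow> g j = (\<lambda>x. x)"
  shows "foldr g coord_list = g i"
proof -
  have "foldr g js = (if i \<in> set js then g i else (\<lambda>x. x))" if "distinct js" for js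
    using that
  proof (induction js)
    case (Cons j js)
    then show ?case
      using assms[of j] by (cases "j = i") (auto simp: fun_eq_iff)
  qed (simp add: fun_eq_iff)
  then show ?thesis
    using coord_list[where 'n = 'n] by simp
qed

lemma foldr_ident: "(\<And>j. g j = (\<lambda>x. x)) \<Longrightarrow> foldr g js = (\<lambda>x. x)"
  by (induction js) (auto simp: fun_eq_iff)

lemma fdiff_multi_0: "fdiff_multi 0 u = u"
  by (simp add: fdiff_multi_def foldr_ident id_def)

lemma fdiff_multi_axis: "fdiff_multi (axis j 1) u = fdiff j u"
  unfolding fdiff_multi_def by (subst foldr_coord_single[of j]) (auto simp: axis_def)

lemma falling_D_multi_axis: "falling_D_multi (axis j N) f = falling_D j N f"
  unfolding falling_D_multi_def by (subst foldr_coord_single[of j]) (auto simp: axis_def)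

lemma mi_order_axis: "mi_order (axis j N) = N"
  by (simp add: mi_order_def axis_def)

text \<open>The symbol estimates are read at \<beta> = \<open>axis i l\<close>, once with \<alpha> =
  0 and once with \<alpha> = \<open>axis j 1\<close>; the difference lowers the order by
  one.\<close>

lemma symbol_class_tame:
  assumes a: "a \<in> symbol_class m"
  shows "tame i N (\<lambda>k. bracket k powr m) a"
    and "tame i N (\<lambda>k. bracket k powr (m - 1)) (\<lambda>k x. a (k + axis j 1) x - a k x)"
proof -
  have sp: "smooth (a k)" "periodic (a k)" for k
    using a by (auto simp: symbol_class_def)
  have b: "\<exists>C. \<forall>k x. cmod (falling_D i l (\<lambda>y. fdiff_multi \<alpha> (\<lambda>l. a l y) k) x)
        \<le> C * bracket k powr (m - real (mi_order \<alpha>))" for l \<alpha>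
    using a unfolding symbol_class_def bracket_def falling_D_multi_axis[symmetric] by blast
  show "tame i N (\<lambda>k. bracket k powr m) a"
    using b[of _ 0] by (intro tame_if_falling_D_bounds sp) (simp add: fdiff_multi_0 mi_order_def)
  show "tame i N (\<lambda>k. bracket k powr (m - 1)) (\<lambda>k x. a (k + axis j 1) x - a k x)"
  proof (rule tame_if_falling_D_bounds)
    show "smooth (\<lambda>x. a (k + axis j 1) x - a k x)" for k
      using smooth_linear[OF sp(1) sp(1), of 1 "k + axis j 1" "- 1" k] by simp
    show "periodic (\<lambda>x. a (k + axis j 1) x - a k x)" for k
      using sp(2) by (simp add: periodic_def)
    show "\<exists>C. \<forall>k x. cmod (falling_D i l (\<lambda>x. a (k + axis j 1) x - a k x) x) \<le> C * bracket k powr (m - 1)" for l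
      using b[of l "axis j 1"] unfolding fdiff_multi_axis mi_order_axis fdiff_def of_nat_1 .
  qed
qed

text \<open>Telescoping along a lattice path from \<open>k\<close> to \<open>k + q\<close> that stays within distance \<open>|q|\<close> of \<open>k\<close>.\<close>

lemma lattice_path_bound:
  fixes c :: "int ^ 'n \<Rightarrow> complex"
  assumes B: "B \<ge> 0" "\<And>j k. cmod (c (k + axis j 1) - c k) \<le> B * bracket k powr s"
  shows "cmod (c (k + q) - c k) \<le> real CARD('n) * B * bracket k powr s * bracket q powr (\<bar>s\<bar> + 1)"
proof -
  let ?X = "\<lambda>q. B * bracket k powr s * bracket q powr \<bar>s\<bar>"
  \<comment> \<open>Peetre's inequality refers the weight at \<open>k + q\<close> back to
    \<open>k\<close>, so that all steps of the path are measured at its starting point.\<close>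
  have step: "cmod (c (k + q + axis j 1) - c (k + q)) \<le> ?X q" for q j
    using order_trans[OF B(2)[of "k + q" j] mult_left_mono[OF bracket_peetre B(1)]] by (simp add: mult.assoc)
  have mono: "?X r \<le> ?X q" if "\<And>j. \<bar>r $ j\<bar> \<le> \<bar>q $ j\<bar>" for r q
  proof -
    have "norm (rvec r) \<le> norm (rvec q)"
    proof (rule norm_le_componentwise_cart)
      show "norm (rvec r $ j) \<le> norm (rvec q $ j)" for j
        using that[of j] by simp
    qed
    then have "bracket r powr \<bar>s\<bar> \<le> bracket q powr \<bar>s\<bar>"
      by (intro powr_mono2) (auto simp: bracket_def)
    then show ?thesis
      using B by (intro mult_left_mono) auto
  qed
  have main: "cmod (c (k + q) - c k) \<le> real (\<Sum>j\<in>UNIV. nat \<bar>q $ j\<bar>) * ?X q" for q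
  proof (induction "\<Sum>j\<in>UNIV. nat \<bar>q $ j\<bar>" arbitrary: q)
    case 0
    then have "q = 0"
      by (simp add: vec_eq_iff)
    then show ?case by simp
  next
    case (Suc M)
    then obtain i where i: "q $ i \<noteq> 0"
      by (metis (mono_tags, lifting) abs_zero nat.distinct(1) nat_0_iff order_refl sum.neutral)
    define r where "r = (if q $ i > 0 then q - axis i 1 else q + axis i 1)"
    have ri: "nat \<bar>q $ i\<bar> = Suc (nat \<bar>r $ i\<bar>)" and rj: "\<And>j. j \<noteq> i \<Longrightarrow> r $ j = q $ j"
      using i by (auto simp: r_def axis_def)
    have rle: "\<bar>r $ j\<bar> \<le> \<bar>q $ j\<bar>" for j
      using ri rj[of j] by (cases "j = i") auto
    have "(\<Sum>j\<in>UNIV. nat \<bar>q $ j\<bar>) = nat \<bar>q $ i\<bar> + (\<Sum>j\<in>UNIV - {i}. nat \<bar>q $ j\<bar>)"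
      by (rule sum.remove) auto
    also have "\<dots> = Suc (nat \<bar>r $ i\<bar> + (\<Sum>j\<in>UNIV - {i}. nat \<bar>r $ j\<bar>))"
      by (simp add: ri rj)
    also have "nat \<bar>r $ i\<bar> + (\<Sum>j\<in>UNIV - {i}. nat \<bar>r $ j\<bar>) = (\<Sum>j\<in>UNIV. nat \<bar>r $ j\<bar>)"
      by (rule sum.remove[symmetric]) auto
    finally have M: "M = (\<Sum>j\<in>UNIV. nat \<bar>r $ j\<bar>)"
      using Suc.hyps(2) by simp
    have "cmod (c (k + q) - c (k + r)) \<le> ?X q"
    \<comment> \<open>A forward difference is bounded at its lower end. This is \<open>k + r\<close>
      for a positive coordinate, where monotonicity passes from \<open>r\<close> to
      \<open>q\<close>, and \<open>k + q\<close> itself for a negative one.\<close>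
    proof (cases "q $ i > 0")
      case True
      then have "k + q = k + r + axis i 1"
        by (simp add: r_def)
      then show ?thesis
        using order_trans[OF step[of r i] mono[OF rle]] by (simp add: add.assoc)
    next
      case False
      then have "k + r = k + q + axis i 1"
        by (simp add: r_def)
      then show ?thesis
        using step[of q i] by (simp add: norm_minus_commute add.assoc)
    qed
    moreover have "cmod (c (k + r) - c k) \<le> real M * ?X q"
      using Suc.hyps(1)[OF M] mult_left_mono[OF mono[OF rle], of "real M"] M by simp
    moreover have "cmod (c (k + q) - c k) \<le> cmod (c (k + q) - c (k + r)) + cmod (c (k + r) - c k)"
      using norm_triangle_ineq[of "c (k + q) - c (k + r)" "c (k + r) - c k"] by simp
    ultimately show ?case
      unfolding Suc.hyps(2)[symmetric] by (simp add: distrib_right)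
  qed
  \<comment> \<open>The number of steps is the l1 length of \<open>q\<close>; it accounts for the
    factor \<open>CARD('n)\<close> and for the extra 1 in the exponent of
    \<open>bracket q\<close>.\<close>
  have "real (\<Sum>j\<in>UNIV. nat \<bar>q $ j\<bar>) = (\<Sum>j\<in>UNIV. \<bar>of_int (q $ j)\<bar>)"
    by simp
  also have "\<dots> \<le> (\<Sum>j\<in>(UNIV :: 'n set). bracket q)"
    by (intro sum_mono abs_le_bracket)
  finally have "real (\<Sum>j\<in>UNIV. nat \<bar>q $ j\<bar>) * ?X q \<le> (real CARD('n) * bracket q) * ?X q"
    using B by (intro mult_right_mono) auto
  with main[of q] show ?thesis
    by (simp add: powr_add mult_ac)
qed


subsection \<open>Matrices of elliptic operators\<close>

lemma bracket_powr_mono: "a \<le> b \<Longrightarrow> bracket k powr a \<le> bracket k powr b"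
  using bracket_ge_1[of k] by (rule powr_mono[rotated])

lemma schwartz_decay:
  fixes u :: "int ^ 'n \<Rightarrow> complex"
  assumes "u \<in> schwartz"
  shows "\<exists>C. \<forall>k. cmod (u k) \<le> C * decay k"
proof -
  have b: "\<exists>B. \<forall>k. cmod ((\<Prod>j\<in>UNIV. of_int (k $ j) ^ (\<alpha> $ j)) * u k) \<le> B" for \<alpha> :: "nat ^ 'n"
  proof -
    have "bdd_above (range (\<lambda>k. cmod ((\<Prod>j\<in>UNIV. of_int (k $ j) ^ (\<alpha> $ j)) * fdiff_multi 0 u k)))"
      by (rule assms[unfolded schwartz_def mem_Collect_eq, rule_format])
    then show ?thesis
      unfolding fdiff_multi_0 bdd_above_def by auto
  qed
  have "(\<Prod>j\<in>UNIV. of_int (k $ j) ^ (axis i N $ j)) = (of_int (k $ i) ^ N :: complex)" for k :: "int ^ 'n" and i N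
    by (subst prod.remove[of _ i]) (auto simp: axis_def)
  then have "\<exists>B. \<forall>k. \<bar>of_int (k $ i)\<bar> ^ N * cmod (u k) \<le> B" for i N
    using b[of "axis i N"] by (simp add: norm_mult norm_power)
  then obtain B where B: "\<And>i N k. \<bar>of_int (k $ i)\<bar> ^ N * cmod (u k) \<le> B i N"
    by metis
  \<comment> \<open>The constant \<open>B undefined 0\<close> bounds \<open>u\<close> itself: a
    zeroth power is 1, whatever the coordinate.\<close>
  have "bracket k ^ (2 * CARD('n)) * cmod (u k) \<le>
    (1 + real CARD('n)) ^ (2 * CARD('n)) * (B undefined 0 + (\<Sum>i\<in>UNIV. B i (2 * CARD('n))))" for k
    by (intro bracket_power_le_bound B) (use B[of k undefined 0] in auto)
  then have "cmod (u k) \<le>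
    ((1 + real CARD('n)) ^ (2 * CARD('n)) * (B undefined 0 + (\<Sum>i\<in>UNIV. B i (2 * CARD('n))))) * decay k" for k
    by (simp add: decay_def pos_le_divide_eq mult.commute)
  then show ?thesis by blast
qed

lemma decay_le_1: "decay k \<le> 1"
  unfolding decay_def using one_le_power[OF bracket_ge_1] by (simp add: divide_le_eq_1_pos)

lemma schwartz_summable:
  assumes "u \<in> schwartz"
  shows "(\<lambda>k. cmod (u k)) summable_on UNIV" and "u \<in> l2"
proof -
  obtain C where C: "\<And>k. cmod (u k) \<le> C * decay k"
    using schwartz_decay[OF assms] by blast
  have s: "(\<lambda>k. C * decay k) summable_on UNIV"
    by (intro summable_on_cmult_right summable_decay)
  then show "(\<lambda>k. cmod (u k)) summable_on UNIV"
    by (rule summable_on_comparison_test) (use C in auto)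
  have "(cmod (u k))\<^sup>2 \<le> \<bar>C\<bar> * (C * decay k)" for k
    unfolding power2_eq_square
  proof (rule mult_mono)
    have "cmod (u k) \<le> \<bar>C\<bar> * decay k"
      using C[of k] by (smt (verit) decay_nonneg mult_right_mono)
    also have "\<dots> \<le> \<bar>C\<bar> * 1"
      by (intro mult_left_mono decay_le_1) auto
    finally show "cmod (u k) \<le> \<bar>C\<bar>" by simp
  qed (use C in auto)
  then show "u \<in> l2"
    unfolding l2_def using summable_on_comparison_test[OF summable_on_cmult_right[OF s, of "\<bar>C\<bar>"]]
    by (metis (no_types, lifting) mem_Collect_eq zero_le_power2)
qed

text \<open>Differences preserve finite support, so every seminorm is a supremum of finitely many
  values. This places basis vectors and truncations in the domain of the operator.\<close>

lemma finite_support_schwartz: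
  fixes u :: "int ^ 'n \<Rightarrow> complex"
  assumes "finite {k. u k \<noteq> 0}"
  shows "u \<in> schwartz"
proof -
  have fd: "finite {k. fdiff j w k \<noteq> 0}" if "finite {k. w k \<noteq> 0}" for j and w :: "int ^ 'n \<Rightarrow> complex"
  proof (rule finite_subset)
    show "{k. fdiff j w k \<noteq> 0} \<subseteq> (\<lambda>k. k - axis j 1) ` {k. w k \<noteq> 0} \<union> {k. w k \<noteq> 0}"
    proof
      fix k assume "k \<in> {k. fdiff j w k \<noteq> 0}"
      then have "w (k + axis j 1) \<noteq> 0 \<or> w k \<noteq> 0"
        by (auto simp: fdiff_def)
      then show "k \<in> (\<lambda>k. k - axis j 1) ` {k. w k \<noteq> 0} \<union> {k. w k \<noteq> 0}"
        by (auto intro!: image_eqI[of k _ "k + axis j 1"])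
    qed
    show "finite ((\<lambda>k. k - axis j 1) ` {k. w k \<noteq> 0} \<union> {k. w k \<noteq> 0})"
      using that by simp
  qed
  have fdn: "finite {k. (fdiff j ^^ N) w k \<noteq> 0}" if "finite {k. w k \<noteq> 0}" for j N and w :: "int ^ 'n \<Rightarrow> complex"
    using that by (induction N) (auto intro: fd)
  have fin: "finite {k. fdiff_multi \<beta> u k \<noteq> 0}" for \<beta>
  proof -
    have "finite {k. foldr (\<lambda>j. fdiff j ^^ (\<beta> $ j)) js u k \<noteq> 0}" for js
      using assms by (induction js) (auto intro: fdn)
    then show ?thesis
      by (simp add: fdiff_multi_def)
  qed
  show ?thesis
    unfolding schwartz_def
  proof safe
    fix \<alpha> \<beta> :: "nat ^ 'n"
    let ?f = "\<lambda>k. cmod ((\<Prod>j\<in>UNIV. of_int (k $ j) ^ (\<alpha> $ j)) * fdiff_multi \<beta> u k)"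
    have "range ?f \<subseteq> insert 0 (?f ` {k. fdiff_multi \<beta> u k \<noteq> 0})"
      by auto
    then show "bdd_above (range ?f)"
      using fin[of \<beta>] by (intro bdd_above_finite) (auto intro: finite_subset)
  qed
qed

lemma lattice_fourier_eq: "lattice_fourier u x = (\<Sum>\<^sub>\<infinity>l. character (- l) x * u l)"
  unfolding lattice_fourier_def character_minus ..

text \<open>The matrix of the operator: inserting the series for \<open>lattice_fourier u\<close>
  and integrating term by term turns the product of \<open>character k\<close>, \<open>a k\<close>
  and \<open>character (- l)\<close> into the coefficient at \<open>k - l\<close>.\<close>

lemma pdo_has_sum:
  fixes a :: "int ^ 'n \<Rightarrow> real ^ 'n \<Rightarrow> complex"
  assumes a: "continuous_on UNIV (a k)" "\<And>x. cmod (a k x) \<le> B"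
    and u: "(\<lambda>l. cmod (u l)) summable_on UNIV"
  shows "((\<lambda>l. fcoef (a k) (k - l) * u l) has_sum pdo a u k) UNIV"
proof -
  let ?g = "\<lambda>l x. character k x * a k x * (character (- l) x * u l)"
  have cu: "continuous_on UNIV (\<lambda>x. lattice_fourier u x)"
    unfolding lattice_fourier_eq
    by (rule has_sum_integral_cbox[OF _ u]) (auto simp: norm_mult intro!: continuous_intros)
  have cF: "continuous_on UNIV (\<lambda>x. character k x * a k x * lattice_fourier u x)"
    by (intro continuous_intros a cu)
  have "((\<lambda>l. integral (cbox 0 1) (?g l)) has_sum integral (cbox 0 1) (\<lambda>x. \<Sum>\<^sub>\<infinity>l. ?g l x)) UNIV"
    by (rule has_sum_integral_cbox[OF _ summable_on_cmult_right[OF u, of B]])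
      (auto simp: norm_mult intro!: continuous_intros a mult_right_mono)
  moreover have "integral (cbox 0 1) (?g l) = fcoef (a k) (k - l) * u l" for l
    using character_add[of k "- l"] by (simp add: fcoef_def mult_ac flip: integral_mult_left)
  moreover have "integral (cbox 0 1) (\<lambda>x. \<Sum>\<^sub>\<infinity>l. ?g l x) = pdo a u k"
  proof -
    \<comment> \<open>The operator is defined by a Lebesgue integral, the coefficients by a gauge
      integral; they agree for a continuous integrand on a compact box.\<close>
    have "set_integrable lborel (cbox 0 1) (\<lambda>x. character k x * a k x * lattice_fourier u x)"
      unfolding set_integrable_def
      by (rule borel_integrable_compact) (auto intro: continuous_on_subset[OF cF])
    from set_borel_integral_eq_integral(2)[OF this] show ?thesis
      unfolding pdo_def character_def[symmetric] lattice_fourier_eq infsum_cmult_right' ..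
  qed
  ultimately show ?thesis by simp
qed

lemma l2_bounded:
  assumes "v \<in> l2"
  shows "\<exists>B. \<forall>k. cmod (v k) \<le> B"
proof (intro exI allI)
  fix k
  have "(\<Sum>k\<in>{k}. (cmod (v k))\<^sup>2) \<le> (\<Sum>\<^sub>\<infinity>k. (cmod (v k))\<^sup>2)"
    using assms by (intro finite_sum_le_infsum) (auto simp: l2_def)
  then have "cmod (v k) \<le> sqrt (\<Sum>\<^sub>\<infinity>k. (cmod (v k))\<^sup>2)"
    by (simp add: real_le_rsqrt)
  then show "cmod (v k) \<le> sqrt (\<Sum>\<^sub>\<infinity>k. (cmod (v k))\<^sup>2)" .
qed

lemma small_tail:
  fixes g :: "'a \<Rightarrow> real"
  assumes g: "g summable_on UNIV" "\<And>x. 0 \<le> g x" and "0 < \<delta>"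
  shows "\<exists>F. finite F \<and> (\<lambda>l. if l \<in> F then 0 else g l) summable_on UNIV \<and> (\<Sum>\<^sub>\<infinity>l. if l \<in> F then 0 else g l) < \<delta>"
proof -
  obtain F where F: "finite F" "dist (sum g F) (infsum g UNIV) \<le> \<delta> / 2"
    using infsum_finite_approximation[OF g(1), of "\<delta> / 2"] assms by auto
  have "((\<lambda>l. if l \<in> F then g l else 0) has_sum sum g F) UNIV"
    by (rule has_sum_finite_neutralI[of F]) (use F in auto)
  then have "((\<lambda>l. - (if l \<in> F then g l else 0)) has_sum - sum g F) UNIV"
    by (simp only: has_sum_uminus minus_minus)
  from has_sum_add[OF has_sum_infsum[OF g(1)] this]
  have "((\<lambda>l. if l \<in> F then 0 else g l) has_sum (infsum g UNIV - sum g F)) UNIV"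
    unfolding diff_conv_add_uminus by (simp add: if_distrib cong: has_sum_cong if_cong)
  then have "(\<lambda>l. if l \<in> F then 0 else g l) summable_on UNIV"
    "(\<Sum>\<^sub>\<infinity>l. if l \<in> F then 0 else g l) = infsum g UNIV - sum g F"
    by (auto simp: summable_on_def infsumI)
  then show ?thesis
    using F assms by (auto intro!: exI[of _ F] simp: dist_real_def abs_le_iff abs_if split: if_splits)
qed

text \<open>The bookkeeping for exponents: once \<open>N\<close> exceeds the summability exponent by
  \<open>s\<close>, a loss of \<open>s\<close> powers still leaves a summable kernel.\<close>

lemma inverse_bracket_power_le_decay:
  fixes p :: "int ^ 'n"
  assumes "real (2 * CARD('n)) + s \<le> real N"
  shows "bracket p powr s / bracket p ^ N \<le> decay p"
proof -
  have "bracket p powr s / bracket p ^ N = bracket p powr (s - real N)"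
    by (simp add: powr_diff flip: powr_realpow)
  also have "\<dots> \<le> bracket p powr (- real (2 * CARD('n)))"
    by (intro bracket_powr_mono) (use assms in auto)
  also have "\<dots> = decay p"
    unfolding decay_def powr_minus_divide by (subst powr_realpow) auto
  finally show ?thesis .
qed

lemma summable_decay_decay:
  "(\<lambda>(j, l). decay (k - j) * decay (j - l)) summable_on (UNIV \<times> (UNIV :: (int ^ 'n) set))"
proof -
  have "(\<lambda>(x :: int ^ 'n, y :: int ^ 'n). decay x * decay y) summable_on (UNIV \<times> UNIV)"
    by (rule summable_on_Times_nonneg) (auto intro: summable_decay)
  also have "?this \<longleftrightarrow> ?thesis"
    by (rule summable_on_reindex_bij_witness[of _ "\<lambda>(j, l). (k - j, j - l)" "\<lambda>(x, y). (k - x, k - x - y)"]) auto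
  finally show ?thesis .
qed

text \<open>
  The operator has the matrix \<open>c k (k - l)\<close>; away from a finite set, \<open>d k\<close> is the inverse of
  \<open>c k\<close> with respect to convolution, i.e. the sequence of Fourier coefficients of the reciprocal of
  the symbol at \<open>k\<close>.
\<close>

locale elliptic_kernel =
  fixes c d :: "int ^ 'n \<Rightarrow> int ^ 'n \<Rightarrow> complex" and m R :: real
  assumes m_pos: "m > 0"
    and c_decay: "\<And>N. \<exists>C. \<forall>k p. cmod (c k p) \<le> C * bracket k powr m / bracket p ^ N"
    and c_diff_decay: "\<And>N. \<exists>C. \<forall>k q p.
      cmod (c (k + q) p - c k p) \<le> C * bracket k powr (m - 1) * bracket q powr (\<bar>m - 1\<bar> + 1) / bracket p ^ N"
    and d_decay: "\<And>N. \<exists>C. \<forall>k p. cmod (d k p) \<le> C * bracket k powr (- m) / bracket p ^ N"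
    and parametrix: "\<And>k q. norm (rvec k) > R \<Longrightarrow>
      ((\<lambda>p. c k p * d k (q - p)) has_sum (if q = 0 then 1 else 0)) UNIV"
begin

lemma c_bound: "\<exists>C\<ge>0. \<forall>k p. cmod (c k p) \<le> C * bracket k powr m * decay p"
proof -
  obtain C where C: "\<And>k p. cmod (c k p) \<le> C * bracket k powr m / bracket p ^ (2 * CARD('n))"
    using c_decay by blast
  have "C \<ge> 0"
    using order_trans[OF norm_ge_zero C[of 0 0]] by (simp add: bracket_def)
  with C show ?thesis
    unfolding decay_def by auto
qed

lemma d_bound: "\<exists>C\<ge>0. \<forall>k p. cmod (d k p) \<le> C * bracket k powr (- m) * decay p"
proof -
  obtain C where C: "\<And>k p. cmod (d k p) \<le> C * bracket k powr (- m) / bracket p ^ (2 * CARD('n))"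
    using d_decay by blast
  have "C \<ge> 0"
    using order_trans[OF norm_ge_zero C[of 0 0]] by (simp add: bracket_def)
  with C show ?thesis
    unfolding decay_def by auto
qed

lemma conv_summable:
  fixes v :: "int ^ 'n \<Rightarrow> complex"
  assumes "v \<in> l2"
  shows "(\<lambda>l. decay (k - l) * cmod (v l)) summable_on UNIV"
  by (rule conv_l2) (use assms in \<open>auto simp: l2_def summable_decay\<close>)

lemma c_summable:
  assumes v: "v \<in> l2"
  shows "(\<lambda>l. c k (j - l) * v l) summable_on UNIV"
proof -
  obtain C where C: "\<And>k p. cmod (c k p) \<le> C * bracket k powr m * decay p"
    using c_bound by blast
  show ?thesis
  proof (rule summable_on_comparison_norm(2))
    show "(\<lambda>l. C * bracket k powr m * (decay (j - l) * cmod (v l))) summable_on UNIV"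
      by (intro summable_on_cmult_right conv_summable v)
    show "norm (c k (j - l) * v l) \<le> C * bracket k powr m * (decay (j - l) * cmod (v l))" for l
      using mult_right_mono[OF C, of "cmod (v l)"] by (simp add: norm_mult mult.assoc)
  qed
qed

text \<open>Since \<open>k\<close> is frozen in both factors, the double sum is an associative
  convolution: the convolution of \<open>d k\<close> and \<open>c k\<close> is a unit mass at 0,
  which reproduces \<open>v k\<close>. The inner sum uses \<open>c k (j - l)\<close>, not the matrix
  entry \<open>c j (j - l)\<close>.\<close>

lemma parametrix_identity:
  assumes v: "v \<in> l2" and k: "norm (rvec k) > R"
  shows "(\<Sum>\<^sub>\<infinity>j. d k (k - j) * (\<Sum>\<^sub>\<infinity>l. c k (j - l) * v l)) = v k"
proof -
  obtain C where C: "\<And>k p. cmod (c k p) \<le> C * bracket k powr m * decay p" "C \<ge> 0"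
    using c_bound by blast
  obtain D where D: "\<And>k p. cmod (d k p) \<le> D * bracket k powr (- m) * decay p" "D \<ge> 0"
    using d_bound by blast
  obtain B where B: "\<And>l. cmod (v l) \<le> B"
    using l2_bounded[OF v] by blast
  \<comment> \<open>For fixed \<open>k\<close> the powers of \<open>bracket k\<close> are constants,
    and boundedness of \<open>v\<close> is enough for the absolute convergence that permits
    exchanging the sums.\<close>
  define X where "X = D * bracket k powr (- m) * (C * bracket k powr m) * B"
  let ?f = "\<lambda>j l. d k (k - j) * (c k (j - l) * v l)"
  have s: "(\<lambda>(j, l). ?f j l) summable_on (UNIV \<times> UNIV)"
  proof (rule summable_on_comparison_norm(2))
    show "(\<lambda>x. X * (\<lambda>(j, l). decay (k - j) * decay (j - l)) x) summable_on (UNIV \<times> UNIV)"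
      by (intro summable_on_cmult_right summable_decay_decay)
    show "norm (case x of (j, l) \<Rightarrow> ?f j l) \<le> X * (case x of (j, l) \<Rightarrow> decay (k - j) * decay (j - l))" for x
    proof (cases x)
      case (Pair j l)
      have "cmod (?f j l) \<le> (D * bracket k powr (- m) * decay (k - j)) * ((C * bracket k powr m * decay (j - l)) * B)"
        unfolding norm_mult using C D B by (intro mult_mono C D B mult_nonneg_nonneg) auto
      then show ?thesis
        by (simp add: Pair X_def mult_ac)
    qed
  qed
  have "(\<Sum>\<^sub>\<infinity>j. d k (k - j) * (\<Sum>\<^sub>\<infinity>l. c k (j - l) * v l)) = (\<Sum>\<^sub>\<infinity>j. \<Sum>\<^sub>\<infinity>l. ?f j l)"
    by (simp add: infsum_cmult_right')
  also have "\<dots> = (\<Sum>\<^sub>\<infinity>l. \<Sum>\<^sub>\<infinity>j. ?f j l)"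
    by (rule infsum_swap_banach[OF s])
  also have "\<dots> = (\<Sum>\<^sub>\<infinity>l. if l = k then v k else 0)"
  proof (rule infsum_cong)
    fix l
    have "((\<lambda>p. c k p * d k (k - l - p)) has_sum (if k - l = 0 then 1 else 0)) UNIV"
      by (rule parametrix[OF k])
    also have "?this \<longleftrightarrow> ((\<lambda>j. c k (j - l) * d k (k - j)) has_sum (if k - l = 0 then 1 else 0)) UNIV"
      by (rule has_sum_reindex_bij_witness[of _ "\<lambda>j. j - l" "\<lambda>p. p + l"]) (auto simp: algebra_simps)
    finally have "((\<lambda>j. v l * (c k (j - l) * d k (k - j))) has_sum v l * (if k - l = 0 then 1 else 0)) UNIV"
      by (rule has_sum_cmult_right)
    from infsumI[OF this] show "(\<Sum>\<^sub>\<infinity>j. ?f j l) = (if l = k then v k else 0)"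
      by (auto simp: mult_ac)
  qed
  also have "\<dots> = v k"
    by (rule infsumI, rule has_sum_finite_neutralI[of "{k}"]) auto
  finally show ?thesis .
qed

end


subsection \<open>Elliptic regularity\<close>

lemma infsum_diff:
  fixes f g :: "'a \<Rightarrow> 'b::real_normed_vector"
  assumes "f summable_on A" "g summable_on A"
  shows "infsum (\<lambda>x. f x - g x) A = infsum f A - infsum g A"
  using infsum_add[OF assms(1), of "\<lambda>x. - g x"] assms(2)
  by (simp add: infsum_uminus summable_on_uminus)

lemma sq_summable_add:
  fixes f g :: "'a \<Rightarrow> real"
  assumes "(\<lambda>k. (f k)\<^sup>2) summable_on UNIV" "(\<lambda>k. (g k)\<^sup>2) summable_on UNIV"
  shows "(\<lambda>k. (f k + g k)\<^sup>2) summable_on UNIV"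
proof (rule summable_on_comparison_test)
  show "(\<lambda>k. 2 * ((f k)\<^sup>2 + (g k)\<^sup>2)) summable_on UNIV"
    by (intro summable_on_cmult_right summable_on_add assms)
  show "(f k + g k)\<^sup>2 \<le> 2 * ((f k)\<^sup>2 + (g k)\<^sup>2)" for k
    using zero_le_power2[of "f k - g k"] by (simp add: power2_sum power2_diff)
qed auto

lemma sq_summable_cmult:
  fixes f :: "'a \<Rightarrow> real"
  assumes "(\<lambda>k. (f k)\<^sup>2) summable_on UNIV"
  shows "(\<lambda>k. (c * f k)\<^sup>2) summable_on UNIV"
  unfolding power_mult_distrib by (intro summable_on_cmult_right assms)

lemma sq_summable_mono:
  fixes f g :: "'a \<Rightarrow> real"
  assumes "(\<lambda>k. (g k)\<^sup>2) summable_on UNIV" "\<And>k. 0 \<le> f k" "\<And>k. f k \<le> g k"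
  shows "(\<lambda>k. (f k)\<^sup>2) summable_on UNIV"
  by (rule summable_on_comparison_test[OF assms(1)]) (use assms in \<open>auto intro: power_mono\<close>)

context elliptic_kernel
begin

lemma regularity_step:
  assumes v: "v \<in> l2" and w: "w \<in> l2" and eq: "\<And>j. (\<Sum>\<^sub>\<infinity>l. c j (j - l) * v l) = w j"
    and s: "0 \<le> s" "(\<lambda>k. (bracket k powr s * cmod (v k))\<^sup>2) summable_on UNIV"
    and t: "0 \<le> t" "t \<le> m" "t \<le> s + 1"
  shows "(\<lambda>k. (bracket k powr t * cmod (v k))\<^sup>2) summable_on UNIV"
proof -
  define \<mu> where "\<mu> = \<bar>m - 1\<bar> + 1"
  \<comment> \<open>\<open>N\<close> has to pay for the path length exponent \<open>\<mu>\<close>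
    and for two uses of Peetre's inequality with exponent \<open>s\<close>, leaving
    \<open>decay\<close> in both \<open>k - j\<close> and \<open>j - l\<close>.\<close>
  obtain N where N: "real (2 * CARD('n)) + (\<mu> + s) \<le> real N"
    using real_arch_simple by blast
  obtain D0 where D0: "\<And>k p. cmod (d k p) \<le> D0 * bracket k powr (- m) * decay p" "D0 \<ge> 0"
    using d_bound by blast
  obtain D where D: "\<And>k p. cmod (d k p) \<le> D * bracket k powr (- m) / bracket p ^ N"
    using d_decay by blast
  obtain C where C: "\<And>k q p. cmod (c (k + q) p - c k p) \<le> C * bracket k powr (m - 1) * bracket q powr \<mu> / bracket p ^ N"
    using c_diff_decay unfolding \<mu>_def by blast
  have D': "D \<ge> 0"
    using order_trans[OF norm_ge_zero D[of 0 0]] by (simp add: bracket_def)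
  have C': "C \<ge> 0"
    using order_trans[OF norm_ge_zero C[of 0 0 0]] by (simp add: bracket_def)
  define g where "g l = bracket l powr s * cmod (v l)" for l
  have g: "(\<lambda>l. (g l)\<^sup>2) summable_on UNIV" "\<And>l. 0 \<le> g l"
    using s by (auto simp: g_def)
  define G where "G j = (\<Sum>\<^sub>\<infinity>l. decay (j - l) * g l)" for j
  note conv = conv_l2[OF summable_decay decay_nonneg]
  have sG: "(\<lambda>l. decay (j - l) * g l) summable_on UNIV" for j
    by (rule conv(1)[OF g])
  have G: "(\<lambda>j. (G j)\<^sup>2) summable_on UNIV" "\<And>j. 0 \<le> G j"
    unfolding G_def using conv(2)[OF g] g by (auto intro: infsum_nonneg)
  have w2: "(\<lambda>j. (cmod (w j))\<^sup>2) summable_on UNIV"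
    using w by (simp add: l2_def)
  \<comment> \<open>The error made at \<open>j\<close> by freezing the row index at
    \<open>k\<close>.\<close>
  define e where "e k j = (\<Sum>\<^sub>\<infinity>l. (c j (j - l) - c k (j - l)) * v l)" for k j
  have cs: "(\<lambda>l. c k (j - l) * v l) summable_on UNIV" for k j
    by (rule c_summable[OF v])
  have w_eq: "w j = (\<Sum>\<^sub>\<infinity>l. c k (j - l) * v l) + e k j" for k j
    unfolding e_def left_diff_distrib by (subst infsum_diff[OF cs cs]) (simp add: eq)
  have d_est: "bracket k powr t * cmod (d k (k - j)) \<le> D0 * decay (k - j)" for k j
  proof -
    have "bracket k powr t * cmod (d k (k - j)) \<le> bracket k powr t * (D0 * bracket k powr (- m) * decay (k - j))"
      by (intro mult_left_mono D0) auto
    also have "\<dots> = bracket k powr (t - m) * (D0 * decay (k - j))"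
      by (simp add: powr_diff powr_minus divide_inverse)
    also have "\<dots> \<le> 1 * (D0 * decay (k - j))"
      using bracket_powr_mono[of "t - m" 0 k] t D0(2) by (intro mult_right_mono) auto
    finally show ?thesis by simp
  qed
  have e_est: "bracket k powr t * cmod (d k (k - j)) * cmod (e k j) \<le> D * C * (decay (k - j) * G j)" for k j
  proof -
    let ?A = "bracket k powr t * (D * bracket k powr (- m) / bracket (k - j) ^ N)"
    have A: "?A \<ge> 0"
      using D' by simp
    let ?B = "D * C * decay (k - j)"
    have summand: "?A * cmod ((c j (j - l) - c k (j - l)) * v l) \<le> ?B * (decay (j - l) * g l)" for l
    proof -
      have "?A * cmod ((c j (j - l) - c k (j - l)) * v l)
          \<le> ?A * ((C * bracket k powr (m - 1) * bracket (j - k) powr \<mu> / bracket (j - l) ^ N) * cmod (v l))"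
        unfolding norm_mult using C[of k "j - k" "j - l"] A by (intro mult_left_mono mult_right_mono) auto
      also have "\<dots> = (D * C) * (bracket k powr t * bracket k powr (- m) * bracket k powr (m - 1)) *
          (bracket (k - j) powr \<mu> / bracket (k - j) ^ N * (1 / bracket (j - l) ^ N) * cmod (v l))"
        by (simp add: bracket_diff_commute[of j k] field_simps)
      \<comment> \<open>The gain of one power: the orders \<open>- m\<close> of the reciprocal and
        \<open>m - 1\<close> of the difference add up to \<open>- 1\<close>.\<close>
      also have "bracket k powr t * bracket k powr (- m) * bracket k powr (m - 1) = bracket k powr (t - 1)"
        by (simp flip: powr_add)
      also have "(D * C) * bracket k powr (t - 1) *
          (bracket (k - j) powr \<mu> / bracket (k - j) ^ N * (1 / bracket (j - l) ^ N) * cmod (v l))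
        \<le> (D * C) * (bracket (k - j) powr s * (bracket (j - l) powr s * bracket l powr s)) *
          (bracket (k - j) powr \<mu> / bracket (k - j) ^ N * (1 / bracket (j - l) ^ N) * cmod (v l))"
      proof (intro mult_right_mono mult_left_mono)
        \<comment> \<open>The remaining weight travels from \<open>k\<close> to \<open>j\<close> and
          on to \<open>l\<close>, where the hypothesis on \<open>v\<close> with exponent
          \<open>s\<close> applies.\<close>
        have "bracket k powr (t - 1) \<le> bracket k powr s"
          using t by (intro bracket_powr_mono) auto
        also have "\<dots> \<le> bracket (k - j) powr s * bracket j powr s"
          using bracket_peetre'[of k s j] s by simp
        also have "\<dots> \<le> bracket (k - j) powr s * (bracket (j - l) powr s * bracket l powr s)"
          using bracket_peetre'[of j s l] s by (intro mult_left_mono) auto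
        finally show "bracket k powr (t - 1) \<le> bracket (k - j) powr s * (bracket (j - l) powr s * bracket l powr s)" .
      qed (use C' D' in auto)
      also have "\<dots> = (D * C) * ((bracket (k - j) powr (\<mu> + s) / bracket (k - j) ^ N) * (bracket (j - l) powr s / bracket (j - l) ^ N)) * g l"
        by (simp add: g_def powr_add field_simps)
      also have "\<dots> \<le> (D * C) * (decay (k - j) * decay (j - l)) * g l"
        using C' D' N g by (intro mult_right_mono mult_left_mono mult_mono inverse_bracket_power_le_decay)
          (auto simp: \<mu>_def)
      finally show ?thesis by (simp add: mult_ac)
    qed
    have sB: "(\<lambda>l. ?B * (decay (j - l) * g l)) summable_on UNIV"
      by (intro summable_on_cmult_right sG)
    have "?A * cmod (e k j) = cmod (\<Sum>\<^sub>\<infinity>l. of_real ?A * ((c j (j - l) - c k (j - l)) * v l))"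
      unfolding e_def infsum_cmult_right' norm_mult norm_of_real abs_of_nonneg[OF A] ..
    also have "\<dots> \<le> (\<Sum>\<^sub>\<infinity>l. ?B * (decay (j - l) * g l))"
    proof (rule summable_on_comparison_norm(3)[OF sB])
      show "cmod (of_real ?A * ((c j (j - l) - c k (j - l)) * v l)) \<le> ?B * (decay (j - l) * g l)" for l
        using summand[of l] unfolding norm_mult norm_of_real abs_of_nonneg[OF A] .
    qed
    also have "\<dots> = ?B * G j"
      unfolding G_def by (rule infsum_cmult_right')
    finally have 1: "?A * cmod (e k j) \<le> ?B * G j" .
    have "bracket k powr t * cmod (d k (k - j)) * cmod (e k j) \<le> ?A * cmod (e k j)"
      by (intro mult_right_mono mult_left_mono D) auto
    with 1 show ?thesis by (simp add: mult_ac)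
  qed
  define P where "P k = D0 * (\<Sum>\<^sub>\<infinity>j. decay (k - j) * cmod (w j)) + D * C * (\<Sum>\<^sub>\<infinity>j. decay (k - j) * G j)" for k
  have P0: "P k \<ge> 0" for k
    unfolding P_def using D0 D' C' G by (intro add_nonneg_nonneg mult_nonneg_nonneg infsum_nonneg) auto
  have main: "bracket k powr t * cmod (v k) \<le> P k" if k: "norm (rvec k) > R" for k
  proof -
    let ?K = "bracket k powr t"
    have sw: "(\<lambda>j. decay (k - j) * cmod (w j)) summable_on UNIV"
      by (rule conv(1)[OF w2]) simp
    have sg: "(\<lambda>j. decay (k - j) * G j) summable_on UNIV"
      by (rule conv(1)[OF G])
    have b1: "norm (of_real ?K * (d k (k - j) * w j)) \<le> D0 * (decay (k - j) * cmod (w j))" for j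
      using mult_right_mono[OF d_est[of k j], of "cmod (w j)"] by (simp add: norm_mult mult_ac)
    have b2: "norm (of_real ?K * (d k (k - j) * e k j)) \<le> D * C * (decay (k - j) * G j)" for j
      using e_est[of k j] by (simp add: norm_mult mult_ac)
    note c1 = summable_on_comparison_norm[OF summable_on_cmult_right[OF sw] b1]
    note c2 = summable_on_comparison_norm[OF summable_on_cmult_right[OF sg] b2]
    have "of_real ?K * v k = (\<Sum>\<^sub>\<infinity>j. of_real ?K * (d k (k - j) * (\<Sum>\<^sub>\<infinity>l. c k (j - l) * v l)))"
      using parametrix_identity[OF v k] by (simp only: infsum_cmult_right')
    also have "\<dots> = (\<Sum>\<^sub>\<infinity>j. of_real ?K * (d k (k - j) * w j) - of_real ?K * (d k (k - j) * e k j))"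
      by (rule infsum_cong) (simp add: w_eq[of _ k] algebra_simps)
    also have "\<dots> = (\<Sum>\<^sub>\<infinity>j. of_real ?K * (d k (k - j) * w j)) - (\<Sum>\<^sub>\<infinity>j. of_real ?K * (d k (k - j) * e k j))"
      by (rule infsum_diff[OF c1(2) c2(2)])
    finally have "cmod (of_real ?K * v k) \<le>
        cmod (\<Sum>\<^sub>\<infinity>j. of_real ?K * (d k (k - j) * w j)) + cmod (\<Sum>\<^sub>\<infinity>j. of_real ?K * (d k (k - j) * e k j))"
      by (simp only: norm_triangle_ineq4)
    also have "\<dots> \<le> P k"
      unfolding P_def using c1(3) c2(3) by (intro add_mono) (simp_all only: infsum_cmult_right')
    finally show ?thesis
      by (simp add: norm_mult)
  qed
  have "(\<lambda>k. (P k)\<^sup>2) summable_on UNIV"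
    unfolding P_def by (intro sq_summable_add sq_summable_cmult conv(2)[OF w2] conv(2)[OF G]) simp
  \<comment> \<open>For |k| at most \<open>R\<close> there is no parametrix, but there the weight is
    bounded and square summability of \<open>v\<close> suffices.\<close>
  moreover have "(\<lambda>k. ((1 + \<bar>R\<bar>) powr t * cmod (v k))\<^sup>2) summable_on UNIV"
    using v by (intro sq_summable_cmult) (simp add: l2_def)
  ultimately have "(\<lambda>k. (P k + (1 + \<bar>R\<bar>) powr t * cmod (v k))\<^sup>2) summable_on UNIV"
    by (rule sq_summable_add)
  then show ?thesis
  proof (rule sq_summable_mono)
    fix k
    show "bracket k powr t * cmod (v k) \<le> P k + (1 + \<bar>R\<bar>) powr t * cmod (v k)"
    proof (cases "norm (rvec k) > R")
      case True
      then show ?thesis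
        using main[of k] by (simp add: add_increasing2)
    next
      case False
      then have "bracket k powr t \<le> (1 + \<bar>R\<bar>) powr t"
        using t by (intro powr_mono2) (auto simp: bracket_def)
      then show ?thesis
        using P0[of k] by (simp add: add_increasing mult_right_mono)
    qed
  qed simp
qed

lemma regularity:
  assumes v: "v \<in> l2" and w: "w \<in> l2" and eq: "\<And>j. (\<Sum>\<^sub>\<infinity>l. c j (j - l) * v l) = w j"
  shows "(\<lambda>k. (bracket k powr m * cmod (v k))\<^sup>2) summable_on UNIV"
proof -
  \<comment> \<open>Iteration starts at weight zero, where the claim is \<open>v \<in> l2\<close>,
    and adds one power per step, capped at \<open>m\<close>.\<close>
  have "(\<lambda>k. (bracket k powr (min m (real i)) * cmod (v k))\<^sup>2) summable_on UNIV" for i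
  proof (induction i)
    case 0
    then show ?case
      using v m_pos by (simp add: l2_def)
  next
    case (Suc i)
    show ?case
      by (rule regularity_step[OF v w eq _ Suc]) (use m_pos in auto)
  qed
  moreover obtain i where "m \<le> real i"
    using real_arch_simple by blast
  ultimately show ?thesis
    by (metis min.absorb1)
qed

text \<open>Peetre's inequality transfers the growth \<open>bracket k powr m\<close> of row
  \<open>k\<close> to the column index \<open>l\<close>. The error of a truncation in the image is
  thus dominated by \<open>decay\<close> convolved with the tail of
  \<open>bracket l powr m * cmod (v l)\<close>, which is small in norm by regularity.\<close>

lemma finite_support_approx:
  assumes v: "v \<in> l2" and w: "w \<in> l2" and eq: "\<And>j. (\<Sum>\<^sub>\<infinity>l. c j (j - l) * v l) = w j" and "0 < \<epsilon>"
  shows "\<exists>F. finite F \<and> l2_dist v (\<lambda>l. if l \<in> F then v l else 0) < \<epsilon> \<and>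
    l2_dist w (\<lambda>k. \<Sum>\<^sub>\<infinity>l. c k (k - l) * (if l \<in> F then v l else 0)) < \<epsilon>"
proof -
  define g where "g l = bracket l powr m * cmod (v l)" for l
  have g: "(\<lambda>l. (g l)\<^sup>2) summable_on UNIV"
    unfolding g_def by (rule regularity[OF v w eq])
  obtain N where N: "real (2 * CARD('n)) + m \<le> real N"
    using real_arch_simple by blast
  obtain C where C: "\<And>k p. cmod (c k p) \<le> C * bracket k powr m / bracket p ^ N"
    using c_decay by blast
  have C': "C \<ge> 0"
    using order_trans[OF norm_ge_zero C[of 0 0]] by (simp add: bracket_def)
  \<comment> \<open>At least 1 and at least the norm bound of the convolution, so that one tail of
    size below \<epsilon> / H serves both distances.\<close>
  define H where "H = 1 + C * infsum decay (UNIV :: (int ^ 'n) set)"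
  have H: "H \<ge> 1" "C * infsum decay (UNIV :: (int ^ 'n) set) \<le> H"
    unfolding H_def using C' by (auto intro!: mult_nonneg_nonneg infsum_nonneg)
  then have "0 < (\<epsilon> / H)\<^sup>2"
    using \<open>0 < \<epsilon>\<close> by simp
  then obtain F where F: "finite F" "(\<lambda>l. if l \<in> F then 0 else (g l)\<^sup>2) summable_on UNIV"
    "(\<Sum>\<^sub>\<infinity>l. if l \<in> F then 0 else (g l)\<^sup>2) < (\<epsilon> / H)\<^sup>2"
    using small_tail[OF g, of "(\<epsilon> / H)\<^sup>2"] by auto
  define T where "T = (\<Sum>\<^sub>\<infinity>l. if l \<in> F then 0 else (g l)\<^sup>2)"
  have T: "0 \<le> T" "sqrt T < \<epsilon> / H"
    using F(3) \<open>0 < \<epsilon>\<close> H unfolding T_def by (auto intro!: infsum_nonneg real_less_lsqrt)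
  define r where "r l = (if l \<in> F then 0 else v l)" for l
  define h where "h l = (if l \<in> F then 0 else g l)" for l
  have h2: "(h l)\<^sup>2 = (if l \<in> F then 0 else (g l)\<^sup>2)" for l
    by (simp add: h_def)
  have h: "(\<lambda>l. (h l)\<^sup>2) summable_on UNIV" "\<And>l. 0 \<le> h l" "(\<Sum>\<^sub>\<infinity>l. (h l)\<^sup>2) = T"
    unfolding h2 T_def using F(2) by (auto simp: h_def g_def)
  have rh: "cmod (r l) \<le> h l" for l
    using bracket_powr_mono[of 0 m l] m_pos mult_right_mono[of 1 "bracket l powr m" "cmod (v l)"]
    by (auto simp: r_def h_def g_def)
  have r: "(\<lambda>l. (cmod (r l))\<^sup>2) summable_on UNIV"
    by (rule sq_summable_mono[OF h(1)]) (use rh in auto)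
  have sqrtT: "sqrt T < \<epsilon>"
  proof -
    have "\<epsilon> / H \<le> \<epsilon> / 1"
      using H \<open>0 < \<epsilon>\<close> by (intro divide_left_mono) auto
    with T show ?thesis by simp
  qed
  let ?vF = "\<lambda>l. if l \<in> F then v l else 0"
  have "l2_dist v ?vF \<le> sqrt T"
  proof -
    have "v l - ?vF l = r l" for l
      by (simp add: r_def)
    then have "l2_dist v ?vF = sqrt (\<Sum>\<^sub>\<infinity>l. (cmod (r l))\<^sup>2)"
      by (simp add: l2_dist_def)
    also have "\<dots> \<le> sqrt (\<Sum>\<^sub>\<infinity>l. (h l)\<^sup>2)"
      by (rule real_sqrt_le_mono, rule infsum_mono[OF r h(1) power_mono[OF rh norm_ge_zero]])
    finally show ?thesis
      by (simp add: h)
  qed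
  moreover have "l2_dist w (\<lambda>k. \<Sum>\<^sub>\<infinity>l. c k (k - l) * ?vF l) < \<epsilon>"
  proof -
    note conv = conv_l2[OF summable_decay decay_nonneg h(1,2)]
    have vF: "?vF \<in> l2"
      unfolding l2_def mem_Collect_eq by (rule finite_nonzero_values_imp_summable_on) (use F(1) in \<open>auto intro: finite_subset[of _ F]\<close>)
    have est: "cmod (w k - (\<Sum>\<^sub>\<infinity>l. c k (k - l) * ?vF l)) \<le> C * (\<Sum>\<^sub>\<infinity>l. decay (k - l) * h l)" for k
    proof -
      have "w k - (\<Sum>\<^sub>\<infinity>l. c k (k - l) * ?vF l) = (\<Sum>\<^sub>\<infinity>l. c k (k - l) * v l - c k (k - l) * ?vF l)"
        unfolding eq[symmetric] by (rule infsum_diff[symmetric]) (intro c_summable v vF)+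
      also have "\<dots> = (\<Sum>\<^sub>\<infinity>l. c k (k - l) * r l)"
        by (rule infsum_cong) (simp add: r_def)
      finally have eq': "w k - (\<Sum>\<^sub>\<infinity>l. c k (k - l) * ?vF l) = (\<Sum>\<^sub>\<infinity>l. c k (k - l) * r l)" .
      have "cmod (\<Sum>\<^sub>\<infinity>l. c k (k - l) * r l) \<le> (\<Sum>\<^sub>\<infinity>l. C * (decay (k - l) * h l))"
      proof (rule summable_on_comparison_norm(3)[OF summable_on_cmult_right[OF conv(1)]])
        fix l
        show "cmod (c k (k - l) * r l) \<le> C * (decay (k - l) * h l)"
        proof (cases "l \<in> F")
          case False
          have "cmod (c k (k - l)) \<le> C * bracket k powr m / bracket (k - l) ^ N"
            by (rule C)
          also have "\<dots> \<le> C * (bracket (k - l) powr m * bracket l powr m) / bracket (k - l) ^ N"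
            using bracket_peetre'[of k m l] m_pos C' by (intro divide_right_mono mult_left_mono) auto
          also have "\<dots> = C * (bracket (k - l) powr m / bracket (k - l) ^ N) * bracket l powr m"
            by simp
          also have "\<dots> \<le> C * decay (k - l) * bracket l powr m"
            using C' N by (intro mult_right_mono mult_left_mono inverse_bracket_power_le_decay) auto
          finally have "cmod (c k (k - l)) * cmod (v l) \<le> C * decay (k - l) * bracket l powr m * cmod (v l)"
            by (rule mult_right_mono) simp
          then show ?thesis
            using False by (simp add: norm_mult r_def h_def g_def mult_ac)
        qed (simp add: r_def h_def)
      qed
      then show ?thesis
        by (simp add: eq' infsum_cmult_right')
    qed
    let ?c = "\<lambda>k. \<Sum>\<^sub>\<infinity>l. decay (k - l) * h l"
    have sc: "(\<lambda>k. (C * ?c k)\<^sup>2) summable_on UNIV"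
      by (intro sq_summable_cmult conv(2))
    have "(l2_dist w (\<lambda>k. \<Sum>\<^sub>\<infinity>l. c k (k - l) * ?vF l))\<^sup>2 = (\<Sum>\<^sub>\<infinity>k. (cmod (w k - (\<Sum>\<^sub>\<infinity>l. c k (k - l) * ?vF l)))\<^sup>2)"
      unfolding l2_dist_def by (simp add: infsum_nonneg)
    also have "\<dots> \<le> (\<Sum>\<^sub>\<infinity>k. (C * ?c k)\<^sup>2)"
    proof (rule infsum_mono[OF sq_summable_mono[OF sc norm_ge_zero est] sc])
      show "(cmod (w k - (\<Sum>\<^sub>\<infinity>l. c k (k - l) * ?vF l)))\<^sup>2 \<le> (C * ?c k)\<^sup>2" for k
        by (rule power_mono[OF est norm_ge_zero])
    qed
    also have "\<dots> = C\<^sup>2 * (\<Sum>\<^sub>\<infinity>k. (?c k)\<^sup>2)"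
      unfolding power_mult_distrib by (rule infsum_cmult_right')
    also have "\<dots> \<le> C\<^sup>2 * ((infsum decay (UNIV :: (int ^ 'n) set))\<^sup>2 * T)"
      using conv(3) unfolding h(3) by (rule mult_left_mono) simp
    also have "\<dots> = (C * infsum decay (UNIV :: (int ^ 'n) set) * sqrt T)\<^sup>2"
      using T by (simp add: power_mult_distrib)
    finally have "l2_dist w (\<lambda>k. \<Sum>\<^sub>\<infinity>l. c k (k - l) * ?vF l) \<le> C * infsum decay (UNIV :: (int ^ 'n) set) * sqrt T"
      by (rule power2_le_imp_le) (use C' T in \<open>auto intro!: mult_nonneg_nonneg infsum_nonneg\<close>)
    also have "\<dots> \<le> H * sqrt T"
      using H T by (intro mult_right_mono) auto
    also have "\<dots> < \<epsilon>"
      using T H by (simp add: field_simps)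
    finally show ?thesis .
  qed
  ultimately show ?thesis
    using F(1) sqrtT by (intro exI[of _ F]) auto
qed

end


subsection \<open>Operators in \<open>\<ell>\<^sup>2\<close>\<close>

lemma l2_I: "(\<lambda>k. (cmod (u k))\<^sup>2) summable_on UNIV \<Longrightarrow> u \<in> l2"
  by (simp add: l2_def)

lemma l2_finite_support:
  assumes "finite {k. u k \<noteq> 0}"
  shows "u \<in> l2"
  unfolding l2_def mem_Collect_eq
  by (rule finite_nonzero_values_imp_summable_on) (use assms in simp)

lemma l2_add:
  assumes "u \<in> l2" "v \<in> l2"
  shows "(\<lambda>k. u k + v k) \<in> l2"
proof (rule l2_I, rule sq_summable_mono)
  show "(\<lambda>k. (cmod (u k) + cmod (v k))\<^sup>2) summable_on UNIV"
    using assms by (intro sq_summable_add) (auto simp: l2_def)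
qed (auto intro: norm_triangle_ineq)

lemma l2_cmult: "u \<in> l2 \<Longrightarrow> (\<lambda>k. c * u k) \<in> l2"
  by (auto simp: l2_def norm_mult intro: sq_summable_cmult)

lemma l2_diff: "u \<in> l2 \<Longrightarrow> v \<in> l2 \<Longrightarrow> (\<lambda>k. u k - v k) \<in> l2"
  using l2_add[OF _ l2_cmult[of v "- 1"], of u] by simp

lemma l2_inner_summable:
  assumes "u \<in> l2" "v \<in> l2"
  shows "(\<lambda>k. u k * cnj (v k)) summable_on UNIV"
    and "cmod (l2_inner u v) \<le> sqrt (\<Sum>\<^sub>\<infinity>k. (cmod (u k))\<^sup>2) * sqrt (\<Sum>\<^sub>\<infinity>k. (cmod (v k))\<^sup>2)"
proof -
  note cs = infsum_Cauchy_Schwarz[of "\<lambda>k. cmod (u k)" UNIV "\<lambda>k. cmod (v k)"]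
  have s: "(\<lambda>k. \<bar>cmod (u k) * cmod (v k)\<bar>) summable_on UNIV"
    using assms by (intro cs) (auto simp: l2_def)
  note n = summable_on_comparison_norm[OF s, of "\<lambda>k. u k * cnj (v k)"]
  show "(\<lambda>k. u k * cnj (v k)) summable_on UNIV"
    by (rule n) (simp add: norm_mult)
  have "cmod (l2_inner u v) \<le> (\<Sum>\<^sub>\<infinity>k. \<bar>cmod (u k) * cmod (v k)\<bar>)"
    unfolding l2_inner_def by (rule n) (simp add: norm_mult)
  also have "\<dots> \<le> sqrt (\<Sum>\<^sub>\<infinity>k. (cmod (u k))\<^sup>2) * sqrt (\<Sum>\<^sub>\<infinity>k. (cmod (v k))\<^sup>2)"
    using assms by (intro cs) (auto simp: l2_def)
  finally show "cmod (l2_inner u v) \<le> sqrt (\<Sum>\<^sub>\<infinity>k. (cmod (u k))\<^sup>2) * sqrt (\<Sum>\<^sub>\<infinity>k. (cmod (v k))\<^sup>2)" .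
qed

lemma l2_inner_cnj: "l2_inner v u = cnj (l2_inner u v)"
  unfolding l2_inner_def by (simp add: mult.commute flip: infsum_cnj)

lemma l2_inner_delta: "l2_inner (\<lambda>l. if l = k then 1 else 0) w = cnj (w k)"
  unfolding l2_inner_def by (rule infsumI, rule has_sum_finite_neutralI[of "{k}"]) auto

lemma l2_inner_dist_left:
  assumes "u \<in> l2" "u' \<in> l2" "v \<in> l2"
  shows "cmod (l2_inner u v - l2_inner u' v) \<le> l2_dist u u' * sqrt (\<Sum>\<^sub>\<infinity>k. (cmod (v k))\<^sup>2)"
proof -
  have "l2_inner u v - l2_inner u' v = l2_inner (\<lambda>k. u k - u' k) v"
    unfolding l2_inner_def left_diff_distrib by (intro infsum_diff[symmetric] l2_inner_summable assms)
  then show ?thesis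
    using l2_inner_summable(2)[OF l2_diff[OF assms(1,2)] assms(3)] by (simp add: l2_dist_def)
qed

lemma l2_inner_dist_right:
  assumes "u \<in> l2" "v \<in> l2" "v' \<in> l2"
  shows "cmod (l2_inner u v - l2_inner u v') \<le> l2_dist v v' * sqrt (\<Sum>\<^sub>\<infinity>k. (cmod (u k))\<^sup>2)"
  using l2_inner_dist_left[OF assms(2,3,1)]
  unfolding l2_inner_cnj[of u] by (simp flip: complex_cnj_diff)

lemma l2_inner_add_right:
  assumes "u \<in> l2" "v \<in> l2" "v' \<in> l2"
  shows "l2_inner u (\<lambda>k. v k + v' k) = l2_inner u v + l2_inner u v'"
  unfolding l2_inner_def complex_cnj_add distrib_left by (intro infsum_add l2_inner_summable assms)

lemma l2_inner_cmult_right: "l2_inner u (\<lambda>k. c * v k) = cnj c * l2_inner u v"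
  unfolding l2_inner_def by (simp add: mult.left_commute infsum_cmult_right')

lemma l2_dist_self: "l2_dist u u = 0"
  by (simp add: l2_dist_def)

lemma subset_op_closure:
  assumes "G \<subseteq> l2 \<times> l2"
  shows "G \<subseteq> op_closure G"
proof safe
  fix u f assume "(u, f) \<in> G"
  then show "(u, f) \<in> op_closure G"
    unfolding op_closure_def using assms by (auto intro!: bexI[of _ "(u, f)"] simp: l2_dist_self)
qed

lemma op_adjoint_antimono: "G \<subseteq> H \<Longrightarrow> op_adjoint H \<subseteq> op_adjoint G"
  unfolding op_adjoint_def by blast

text \<open>Testing against a basis vector in the domain reads off a single value of
  \<open>w\<close>, so the adjoint is single-valued.\<close>

lemma l2_operator_op_adjoint:
  assumes G: "G \<subseteq> l2 \<times> l2" and dom: "\<And>u. finite {k. u k \<noteq> 0} \<Longrightarrow> u \<in> Domain G"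
  shows "l2_operator (op_adjoint G)"
proof -
  have "w k = w' k" if "(v, w) \<in> op_adjoint G" "(v, w') \<in> op_adjoint G" for v w w' k
  proof -
    obtain f where "((\<lambda>l. if l = k then 1 else 0), f) \<in> G"
    proof -
      have "(\<lambda>l. if l = k then 1 else 0) \<in> Domain G"
        by (rule dom) simp
      then show ?thesis
        using that by blast
    qed
    then have "l2_inner f v = cnj (w k)" "l2_inner f v = cnj (w' k)"
      using that by (auto simp: op_adjoint_def l2_inner_delta[symmetric])
    then show ?thesis by (metis complex_cnj_cancel_iff)
  qed
  then have "single_valued (op_adjoint G)"
    by (auto intro!: single_valuedI)
  moreover have "((\<lambda>_. 0), (\<lambda>_. 0)) \<in> op_adjoint G"
    by (auto simp: op_adjoint_def l2_inner_def l2_finite_support)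
  moreover have "((\<lambda>k. u k + v k), (\<lambda>k. f k + g k)) \<in> op_adjoint G"
    if "(u, f) \<in> op_adjoint G" "(v, g) \<in> op_adjoint G" for u f v g
    unfolding op_adjoint_def
  proof (safe intro!: l2_add)
    fix u' f' assume uf: "(u', f') \<in> G"
    then have "l2_inner f' u = l2_inner u' f" "l2_inner f' v = l2_inner u' g"
      using that by (auto simp: op_adjoint_def)
    then show "l2_inner f' (\<lambda>k. u k + v k) = l2_inner u' (\<lambda>k. f k + g k)"
      using uf that G by (subst (1 2) l2_inner_add_right) (auto simp: op_adjoint_def)
  qed (use that in \<open>auto simp: op_adjoint_def\<close>)
  moreover have "((\<lambda>k. c * u k), (\<lambda>k. c * f k)) \<in> op_adjoint G" if "(u, f) \<in> op_adjoint G" for u f c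
    using that by (auto simp: op_adjoint_def l2_inner_cmult_right l2_cmult)
  moreover have "op_adjoint G \<subseteq> l2 \<times> l2"
    by (auto simp: op_adjoint_def)
  ultimately show ?thesis
    unfolding l2_operator_def by blast
qed

text \<open>Symmetry passes to limits in one argument by continuity of the inner product. Two graphs
  are kept apart because the closure is later taken in one argument after the other.\<close>

lemma op_closure_subset_adjoint:
  assumes H: "H \<subseteq> l2 \<times> l2" and G: "G \<subseteq> l2 \<times> l2"
    and sym: "\<And>u f v g. (u, f) \<in> H \<Longrightarrow> (v, g) \<in> G \<Longrightarrow> l2_inner f v = l2_inner u g"
  shows "op_closure G \<subseteq> op_adjoint H"
proof safe
  fix v w assume vw: "(v, w) \<in> op_closure G"
  then have l2: "v \<in> l2" "w \<in> l2"
    by (auto simp: op_closure_def)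
  have "l2_inner f v = l2_inner u w" if uf: "(u, f) \<in> H" for u f
  proof -
    let ?n = "\<lambda>u. sqrt (\<Sum>\<^sub>\<infinity>k. (cmod (u k))\<^sup>2)"
    have uf2: "u \<in> l2" "f \<in> l2"
      using uf H by auto
    have nn: "0 \<le> ?n f" "0 \<le> ?n u"
      by (auto intro: infsum_nonneg)
    have "cmod (l2_inner f v - l2_inner u w) \<le> e" if "e > 0" for e
    proof -
      define \<delta> where "\<delta> = e / (1 + ?n f + ?n u)"
      have \<delta>: "\<delta> > 0"
        unfolding \<delta>_def using that nn by (intro divide_pos_pos) linarith+
      then obtain v' w' where vw': "(v', w') \<in> G" "l2_dist v v' < \<delta>" "l2_dist w w' < \<delta>"
        using vw unfolding op_closure_def by blast
      then have l2': "v' \<in> l2" "w' \<in> l2"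
        using G by auto
      have "l2_inner f v - l2_inner u w = (l2_inner f v - l2_inner f v') - (l2_inner u w - l2_inner u w')"
        using sym[OF uf vw'(1)] by simp
      then have "cmod (l2_inner f v - l2_inner u w) \<le>
          cmod (l2_inner f v - l2_inner f v') + cmod (l2_inner u w - l2_inner u w')"
        by (metis norm_triangle_ineq4)
      also have "\<dots> \<le> l2_dist v v' * ?n f + l2_dist w w' * ?n u"
        by (intro add_mono l2_inner_dist_right uf2 l2 l2')
      also have "\<dots> \<le> \<delta> * ?n f + \<delta> * ?n u"
        using vw' nn by (intro add_mono mult_right_mono) auto
      also have "\<dots> \<le> \<delta> * (1 + ?n f + ?n u)"
        using \<delta> by (simp add: algebra_simps)
      also have "\<dots> = e"
        unfolding \<delta>_def using nn by (simp add: add_nonneg_eq_0_iff)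
      finally show ?thesis .
    qed
    then have "cmod (l2_inner f v - l2_inner u w) \<le> 0"
      by (rule field_le_epsilon) (simp add: that)
    then show ?thesis by simp
  qed
  with l2 show "(v, w) \<in> op_adjoint H"
    by (auto simp: op_adjoint_def)
qed

text \<open>Symmetry places the closure inside its own adjoint. Conversely, the adjoint of the
  closure lies in the adjoint of \<open>G\<close>, which is contained in the closure by
  assumption.\<close>

lemma essentially_self_adjointI:
  assumes G: "l2_operator G" and dom: "\<And>u. finite {k. u k \<noteq> 0} \<Longrightarrow> u \<in> Domain G"
    and sym: "\<And>u f v g. (u, f) \<in> G \<Longrightarrow> (v, g) \<in> G \<Longrightarrow> l2_inner f v = l2_inner u g"
    and sub: "op_adjoint G \<subseteq> op_closure G"
  shows "essentially_self_adjoint G"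
proof -
  let ?C = "op_closure G"
  have G2: "G \<subseteq> l2 \<times> l2"
    using G by (simp add: l2_operator_def)
  have C2: "?C \<subseteq> l2 \<times> l2"
    by (auto simp: op_closure_def)
  have GC: "G \<subseteq> ?C"
    by (rule subset_op_closure[OF G2])
  have "?C \<subseteq> op_adjoint G"
    by (rule op_closure_subset_adjoint[OF G2 G2 sym])
  \<comment> \<open>Conjugation swaps the arguments, so that the closure may now be taken in the
    other one.\<close>
  then have "l2_inner f v = l2_inner u g" if "(u, f) \<in> ?C" "(v, g) \<in> G" for u f v g
  proof -
    have "l2_inner g u = l2_inner v f"
      using \<open>op_closure G \<subseteq> op_adjoint G\<close> that by (auto simp: op_adjoint_def)
    then show ?thesis
      using l2_inner_cnj[of f v] l2_inner_cnj[of u g] by simp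
  qed
  then have "?C \<subseteq> op_adjoint ?C"
    by (rule op_closure_subset_adjoint[OF C2 G2])
  moreover have "op_adjoint ?C \<subseteq> ?C"
    using op_adjoint_antimono[OF GC] sub by blast
  ultimately have eq: "op_adjoint ?C = ?C"
    by blast
  have domC: "u \<in> Domain ?C" if "finite {k. u k \<noteq> 0}" for u
    using dom[OF that] GC by blast
  \<comment> \<open>Closability comes for free: the closure equals an adjoint, and adjoints are
    single-valued here.\<close>
  have "l2_operator ?C"
    using l2_operator_op_adjoint[OF C2 domC] by (simp add: eq)
  moreover have "densely_defined ?C"
    unfolding densely_defined_def
  proof (intro ballI allI impI)
    fix u and \<epsilon> :: real assume u: "u \<in> (l2 :: ('a \<Rightarrow> complex) set)" and "0 < \<epsilon>"
    then have "\<exists>F. finite F \<and> (\<lambda>l. if l \<in> F then 0 else (cmod (u l))\<^sup>2) summable_on UNIV \<and>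
        (\<Sum>\<^sub>\<infinity>l. if l \<in> F then 0 else (cmod (u l))\<^sup>2) < \<epsilon>\<^sup>2"
      by (intro small_tail) (auto simp: l2_def)
    then obtain F where F: "finite F" "(\<Sum>\<^sub>\<infinity>l. if l \<in> F then 0 else (cmod (u l))\<^sup>2) < \<epsilon>\<^sup>2"
      by blast
    have "(cmod (u l - (if l \<in> F then u l else 0)))\<^sup>2 = (if l \<in> F then 0 else (cmod (u l))\<^sup>2)" for l
      by simp
    then have "l2_dist u (\<lambda>l. if l \<in> F then u l else 0) < \<epsilon>"
      unfolding l2_dist_def using F(2) \<open>0 < \<epsilon>\<close> by (simp add: real_less_lsqrt infsum_nonneg)
    moreover have "(\<lambda>l. if l \<in> F then u l else 0) \<in> Domain ?C"
      by (rule domC) (rule finite_subset[OF _ F(1)], auto)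
    ultimately show "\<exists>v\<in>Domain ?C. l2_dist u v < \<epsilon>"
      by blast
  qed
  ultimately show ?thesis
    using G eq by (simp add: essentially_self_adjoint_def self_adjoint_def)
qed

section \<open>The kernel of an elliptic symbol and essential self-adjointness\<close>

lemma fdiff_multi_linear:
  "fdiff_multi \<beta> (\<lambda>k. c * u k + d * v k) = (\<lambda>k. c * fdiff_multi \<beta> u k + d * fdiff_multi \<beta> v k)"
proof -
  have pow: "(fdiff j ^^ N) (\<lambda>k. c * u k + d * v k) = (\<lambda>k. c * (fdiff j ^^ N) u k + d * (fdiff j ^^ N) v k)" for j N u v
    by (induction N) (simp_all add: fdiff_def fun_eq_iff algebra_simps)
  have "foldr (\<lambda>j. fdiff j ^^ (\<beta> $ j)) js (\<lambda>k. c * u k + d * v k)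
    = (\<lambda>k. c * foldr (\<lambda>j. fdiff j ^^ (\<beta> $ j)) js u k + d * foldr (\<lambda>j. fdiff j ^^ (\<beta> $ j)) js v k)" for js
    by (induction js) (simp_all add: pow)
  then show ?thesis
    by (simp add: fdiff_multi_def)
qed

lemma schwartz_linear:
  assumes "u \<in> schwartz" "v \<in> schwartz"
  shows "(\<lambda>k. c * u k + d * v k) \<in> schwartz"
  unfolding schwartz_def mem_Collect_eq
proof (intro allI)
  fix \<alpha> \<beta> :: "nat ^ 'a"
  let ?p = "\<lambda>k. \<Prod>j\<in>UNIV. of_int (k $ j) ^ (\<alpha> $ j) :: complex"
  obtain M where M: "\<And>k. cmod (?p k * fdiff_multi \<beta> u k) \<le> M"
    using assms(1)[unfolded schwartz_def mem_Collect_eq, rule_format, of \<alpha> \<beta>] by (auto simp: bdd_above_def)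
  obtain M' where M': "\<And>k. cmod (?p k * fdiff_multi \<beta> v k) \<le> M'"
    using assms(2)[unfolded schwartz_def mem_Collect_eq, rule_format, of \<alpha> \<beta>] by (auto simp: bdd_above_def)
  show "bdd_above (range (\<lambda>k. cmod (?p k * fdiff_multi \<beta> (\<lambda>k. c * u k + d * v k) k)))"
  proof (rule bdd_aboveI2)
    fix k
    have "?p k * fdiff_multi \<beta> (\<lambda>k. c * u k + d * v k) k
        = c * (?p k * fdiff_multi \<beta> u k) + d * (?p k * fdiff_multi \<beta> v k)"
      by (simp add: fdiff_multi_linear algebra_simps)
    also have "cmod \<dots> \<le> cmod c * cmod (?p k * fdiff_multi \<beta> u k) + cmod d * cmod (?p k * fdiff_multi \<beta> v k)"
      by (rule order_trans[OF norm_triangle_ineq]) (simp only: norm_mult order_refl)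
    also have "\<dots> \<le> cmod c * M + cmod d * M'"
      by (intro add_mono mult_left_mono M M') auto
    finally show "cmod (?p k * fdiff_multi \<beta> (\<lambda>k. c * u k + d * v k) k) \<le> cmod c * M + cmod d * M'" .
  qed
qed

lemma elliptic_kernel_symbol:
  assumes m: "m > 0" and a: "a \<in> elliptic_symbol_class m"
  shows "\<exists>d R. elliptic_kernel (\<lambda>k. fcoef (a k)) d m R"
proof -
  have sym: "a \<in> symbol_class m"
    using a by (simp add: elliptic_symbol_class_def)
  obtain C R where C: "C > 0" "\<And>k x. norm (rvec k) > R \<Longrightarrow> C * bracket k powr m \<le> cmod (a k x)"
    using a unfolding elliptic_symbol_class_def bracket_def by blast
  note tame = symbol_class_tame[OF sym]
  let ?E = "{k. norm (rvec k) > R}"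
  \<comment> \<open>Ellipticity gives the lower bound needed for the reciprocal only for |k| > R;
    setting \<open>b k\<close> to zero elsewhere keeps the estimates uniform over the
    lattice.\<close>
  define b where "b k x = (if k \<in> ?E then 1 / a k x else 0)" for k x
  have b: "tame i N (\<lambda>k. 1 / bracket k powr m) b" for i N
    unfolding b_def by (rule tame_inverse[OF tame(1) _ C(1)]) (use C in auto)
  have dom: "dominated (\<lambda>k. bracket k powr m) a" "dominated (\<lambda>k. 1 / bracket k powr m) b"
    using tame(1) b tame_imp_dominated by blast+
  then have cont: "continuous_on UNIV (a k)" "continuous_on UNIV (b k)" for k
    by (auto simp: dominated_def)
  have "elliptic_kernel (\<lambda>k. fcoef (a k)) (\<lambda>k. fcoef (b k)) m R"
  proof
    show "m > 0" by fact
    show dec: "\<exists>C. \<forall>k p. cmod (fcoef (a k) p) \<le> C * bracket k powr m / bracket p ^ N" for N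
      by (rule tame_fcoef_decay[OF tame(1)])
    show "\<exists>C. \<forall>k p. cmod (fcoef (b k) p) \<le> C * bracket k powr (- m) / bracket p ^ N" for N
      using tame_fcoef_decay[OF b] by (simp add: powr_minus_divide)
    show "\<exists>C. \<forall>k q p. cmod (fcoef (a (k + q)) p - fcoef (a k) p) \<le>
        C * bracket k powr (m - 1) * bracket q powr (\<bar>m - 1\<bar> + 1) / bracket p ^ N" for N
    proof -
      have "\<forall>j. \<exists>C. \<forall>k p. cmod (fcoef (\<lambda>x. a (k + axis j 1) x - a k x) p) \<le> C * bracket k powr (m - 1) / bracket p ^ N"
        by (intro allI tame_fcoef_decay[OF tame(2)])
      from choice[OF this] obtain C where
        C: "\<And>j k p. cmod (fcoef (\<lambda>x. a (k + axis j 1) x - a k x) p) \<le> C j * bracket k powr (m - 1) / bracket p ^ N"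
        by blast
      define S where "S = (\<Sum>j\<in>UNIV. \<bar>C j\<bar>)"
      have S: "C j \<le> S" for j
        unfolding S_def by (rule order_trans[OF abs_ge_self]) (rule member_le_sum, auto)
      have "S \<ge> 0"
        unfolding S_def by (simp add: sum_nonneg)
      have "cmod (fcoef (a (k + q)) p - fcoef (a k) p) \<le>
          real CARD('a) * (S / bracket p ^ N) * bracket k powr (m - 1) * bracket q powr (\<bar>m - 1\<bar> + 1)" for k q p
      \<comment> \<open>The path estimate is used for fixed \<open>p\<close>, as a function of the
        row index alone; the decay in \<open>p\<close> is part of its constant, and \<open>S\<close>
        covers all directions at once.\<close>
      proof (rule lattice_path_bound)
        show "S / bracket p ^ N \<ge> 0"
          using \<open>S \<ge> 0\<close> by simp
        fix j k
        have "cmod (fcoef (a (k + axis j 1)) p - fcoef (a k) p) \<le> C j * bracket k powr (m - 1) / bracket p ^ N"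
          using C[of k j p] by (simp add: fcoef_diff cont)
        also have "\<dots> \<le> S * bracket k powr (m - 1) / bracket p ^ N"
          by (intro divide_right_mono mult_right_mono S) auto
        finally show "cmod (fcoef (a (k + axis j 1)) p - fcoef (a k) p) \<le> S / bracket p ^ N * bracket k powr (m - 1)"
          by simp
      qed
      then have "cmod (fcoef (a (k + q)) p - fcoef (a k) p) \<le>
          (real CARD('a) * S) * bracket k powr (m - 1) * bracket q powr (\<bar>m - 1\<bar> + 1) / bracket p ^ N" for k q p
        by (simp add: mult_ac)
      then show ?thesis by blast
    qed
    show "((\<lambda>p. fcoef (a k) p * fcoef (b k) (q - p)) has_sum (if q = 0 then 1 else 0)) UNIV"
      if k: "norm (rvec k) > R" for k q
    proof -
      obtain D where D: "\<And>x. cmod (b k x) \<le> D"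
        using dom(2) by (auto simp: dominated_def)
      obtain C' where "\<And>k p. cmod (fcoef (a k) p) \<le> C' * bracket k powr m / bracket p ^ (2 * CARD('a))"
        using dec by blast
      then have "(\<lambda>p. cmod (fcoef (a k) p)) summable_on UNIV"
        by (intro summable_on_comparison_test[OF summable_on_cmult_right[OF summable_decay, of "C' * bracket k powr m"]])
          (auto simp: decay_def)
      from fcoef_mult[OF cont(1) this cont(2) D]
      have "((\<lambda>p. fcoef (a k) p * fcoef (b k) (q - p)) has_sum fcoef (\<lambda>x. b k x * a k x) q) UNIV" .
      moreover have "b k x * a k x = 1" for x
      proof -
        have "0 < C * bracket k powr m"
          using C(1) by simp
        then have "a k x \<noteq> 0"
          using C(2)[OF k, of x] by auto
        then show ?thesis
          using k by (simp add: b_def)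
      qed
      ultimately show ?thesis
        by (simp add: fcoef_1)
    qed
  qed
  then show ?thesis by blast
qed

theorem corollary2p9:
  fixes a :: "int ^ 'n \<Rightarrow> real ^ 'n \<Rightarrow> complex"
    and m :: real
    and T_adj :: "(int ^ 'n \<Rightarrow> complex) \<Rightarrow> int ^ 'n \<Rightarrow> complex"
    and A A_adj :: "(int ^ 'n) l2_graph"
  assumes "m > 0"
    and "a \<in> elliptic_symbol_class m"
    and "is_formal_adjoint (pdo a) T_adj"
    and "A = op_graph schwartz (pdo a)"
    and "A_adj = op_graph schwartz T_adj"
    and "A = A_adj"
  shows "essentially_self_adjoint A"
proof -
  obtain d R where "elliptic_kernel (\<lambda>k. fcoef (a k)) d m R"
    using elliptic_kernel_symbol[OF assms(1,2)] by blast
  then interpret elliptic_kernel "\<lambda>k. fcoef (a k)" d m R .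
  have dom: "dominated (\<lambda>k. bracket k powr m) a"
    using assms(2) symbol_class_tame(1) tame_imp_dominated unfolding elliptic_symbol_class_def by blast
  have ker: "((\<lambda>l. fcoef (a k) (k - l) * u l) has_sum pdo a u k) UNIV" if "u \<in> schwartz" for u k
  proof -
    obtain B where "\<And>x. cmod (a k x) \<le> B"
      using dom by (auto simp: dominated_def)
    then show ?thesis
      using dom by (intro pdo_has_sum schwartz_summable that) (auto simp: dominated_def)
  qed
  let ?\<delta> = "\<lambda>k l. if l = k then 1 else 0 :: complex"
  have \<delta>: "?\<delta> k \<in> schwartz" for k
    by (rule finite_support_schwartz) auto
  have pdo_\<delta>: "pdo a (?\<delta> k) l = fcoef (a l) (l - k)" for k l
    by (rule has_sum_unique[OF ker[OF \<delta>]], rule has_sum_finite_neutralI[of "{k}"]) auto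
  \<comment> \<open>Equality of the graphs is equality of the two maps on Schwartz functions; it
    also hands the mapping property of the formal adjoint over to \<open>pdo a\<close>.\<close>
  have adj: "pdo a u = T_adj u" if "u \<in> schwartz" for u
    using assms(4-6) that by (auto simp: op_graph_def set_eq_iff)
  have maps: "pdo a u \<in> schwartz" if "u \<in> schwartz" for u
    using assms(3) adj that by (auto simp: is_formal_adjoint_def)
  have sym: "l2_inner (pdo a u) v = l2_inner u (pdo a v)" if "u \<in> schwartz" "v \<in> schwartz" for u v
    using assms(3) adj that by (auto simp: is_formal_adjoint_def)
  \<comment> \<open>Formal symmetry on pairs of basis vectors says that the matrix is
    Hermitian.\<close>
  have herm: "fcoef (a l) (l - k) = cnj (fcoef (a k) (k - l))" for k l
    using sym[OF \<delta> \<delta>, of k l] l2_inner_cnj[of "pdo a (?\<delta> k)" "?\<delta> l"]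
    by (simp add: l2_inner_delta pdo_\<delta>)
  have lin: "pdo a (\<lambda>k. c * u k + d * v k) = (\<lambda>k. c * pdo a u k + d * pdo a v k)"
    if "u \<in> schwartz" "v \<in> schwartz" for u v c d
  proof
    fix k
    have "((\<lambda>l. c * (fcoef (a k) (k - l) * u l) + d * (fcoef (a k) (k - l) * v l)) has_sum
        c * pdo a u k + d * pdo a v k) UNIV"
      by (intro has_sum_add has_sum_cmult_right ker that)
    then have "((\<lambda>l. fcoef (a k) (k - l) * (c * u l + d * v l)) has_sum c * pdo a u k + d * pdo a v k) UNIV"
      by (simp add: algebra_simps)
    with ker[OF schwartz_linear[OF that]] show "pdo a (\<lambda>k. c * u k + d * v k) k = c * pdo a u k + d * pdo a v k"
      by (rule has_sum_unique)
  qed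
  have mem: "(u, f) \<in> A \<longleftrightarrow> u \<in> schwartz \<and> f = pdo a u" for u f
    using assms(4) by (auto simp: op_graph_def)
  show ?thesis
  proof (rule essentially_self_adjointI)
    have "A \<subseteq> l2 \<times> l2" "single_valued A"
      using mem maps schwartz_summable(2) by (auto intro: single_valuedI)
    moreover have "((\<lambda>_. 0), (\<lambda>_. 0)) \<in> A"
      using lin[OF \<delta> \<delta>, of 0 undefined 0 undefined] finite_support_schwartz[of "\<lambda>_. 0"] by (simp add: mem)
    moreover have "((\<lambda>k. u k + v k), (\<lambda>k. f k + g k)) \<in> A" if "(u, f) \<in> A" "(v, g) \<in> A" for u f v g
      using that lin[of u v 1 1] schwartz_linear[of u v 1 1] by (simp add: mem)
    moreover have "((\<lambda>k. c * u k), (\<lambda>k. c * f k)) \<in> A" if "(u, f) \<in> A" for u f c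
      using that lin[of u u c 0] schwartz_linear[of u u c 0] by (simp add: mem)
    ultimately show "l2_operator A"
      unfolding l2_operator_def by blast
    show "u \<in> Domain A" if "finite {k. u k \<noteq> 0}" for u
      using finite_support_schwartz[OF that] by (auto simp: mem Domain_iff)
    show "l2_inner f v = l2_inner u g" if "(u, f) \<in> A" "(v, g) \<in> A" for u f v g
      using that sym by (simp add: mem)
    show "op_adjoint A \<subseteq> op_closure A"
    proof safe
      fix v w assume vw: "(v, w) \<in> op_adjoint A"
      then have l2: "v \<in> l2" "w \<in> l2"
        by (auto simp: op_adjoint_def)
      have eq: "(\<Sum>\<^sub>\<infinity>l. fcoef (a j) (j - l) * v l) = w j" for j
      proof -
        have "l2_inner (pdo a (?\<delta> j)) v = l2_inner (?\<delta> j) w"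
          using vw \<delta>[of j] by (auto simp: op_adjoint_def mem)
        \<comment> \<open>Testing with the basis vector at \<open>j\<close> yields column
          \<open>j\<close> of the matrix; the Hermitian property turns it into row \<open>j\<close>,
          the form needed for regularity.\<close>
        then have "cnj (\<Sum>\<^sub>\<infinity>l. fcoef (a j) (j - l) * v l) = cnj (w j)"
          by (simp add: l2_inner_delta l2_inner_def pdo_\<delta> herm[of _ j] flip: infsum_cnj)
        then show ?thesis
          by (simp only: complex_cnj_cancel_iff)
      qed
      have "\<exists>(v', w')\<in>A. l2_dist v v' < \<epsilon> \<and> l2_dist w w' < \<epsilon>" if \<epsilon>: "0 < \<epsilon>" for \<epsilon>
      proof -
        obtain F where F: "finite F" "l2_dist v (\<lambda>l. if l \<in> F then v l else 0) < \<epsilon>"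
          "l2_dist w (\<lambda>k. \<Sum>\<^sub>\<infinity>l. fcoef (a k) (k - l) * (if l \<in> F then v l else 0)) < \<epsilon>"
          using finite_support_approx[OF l2 eq \<epsilon>] by blast
        let ?v = "\<lambda>l. if l \<in> F then v l else 0"
        have v': "?v \<in> schwartz"
          by (rule finite_support_schwartz, rule finite_subset[OF _ F(1)]) auto
        have "(\<lambda>k. \<Sum>\<^sub>\<infinity>l. fcoef (a k) (k - l) * ?v l) = pdo a ?v"
          using infsumI[OF ker[OF v']] by (rule ext)
        with F v' show ?thesis
          by (intro bexI[of _ "(?v, pdo a ?v)"]) (auto simp: mem)
      qed
      with l2 show "(v, w) \<in> op_closure A"
        by (auto simp: op_closure_def)
    qed
  qed
qed

end
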